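(* For any $\alpha>0$, $\xi>0$ and $\epsilon'>0$, there exist $c>0$ and $\epsilon>0$ of size at least polynomial in $\alpha,\xi,\epsilon'$ such that the following holds. Let $p\in(0,1]$ and $q_{XY},q_{XZ},q_{YZ}\in[\alpha p,p]$. Let $\Gamma$ be a tripartite graph with vertex sets $X$, $Y$ and $Z$ and let $G$ be a subgraph of $\Gamma$. Suppose that (i) $(X,Y)_\Gamma$ is $(p,cp^4\sqrt{|X||Y|})$-jumbled and $(X,Y)_G$ satisfies $\mathrm{DISC}(q_{XY},p,\epsilon)$; (ii) $(X,Z)_\Gamma$ is $(p,cp^2\sqrt{|X||Z|})$-jumbled and $(X,Z)_G$ satisfies $\mathrm{DISC}(q_{XZ},p,\epsilon)$; and (iii) $(Y,Z)_\Gamma$ is $(p,cp^3\sqrt{|Y||Z|})$-jumbled and $(Y,Z)_G$ satisfies $\mathrm{DISC}(q_{YZ},p,\epsilon)$. Then at least $(1-\xi)|Z|$ vertices $z\in Z$ have the property that $|N_X(z)|\ge(1-\xi)q_{XZ}|X|$, $|N_Y(z)|\ge(1-\xi)q_{YZ}|Y|$, and $(N_X(z),N_Y(z))_G$ satisfies $\mathrm{DISC}(q_{XY},p,\epsilon')$.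
   Context: Graphs are finite and simple; vertex sets are nonempty. A graph $G$ is identified with the characteristic function $G(x,y)\in\{0,1\}$ of its edge set, and $(X,Y)_G$ denotes the bipartite graph induced between $X$ and $Y$. $N_X(z)$ and $N_Y(z)$ denote the sets of neighbours of $z$ in the graph $G$ lying in $X$ and $Y$ respectively. A bipartite graph $\Gamma$ between $X$ and $Y$ is $(p,\beta)$-jumbled if $\left|\sum_{x\in X,y\in Y}(\Gamma(x,y)-p)u(x)v(y)\right|\le\beta\sqrt{\sum_{x\in X} u(x)}\sqrt{\sum_{y\in Y} v(y)}$ for all $u:X\to[0,1]$, $v:Y\to[0,1]$. A bipartite graph $G$ between $X$ and $Y$ satisfies $\mathrm{DISC}(q,p,\epsilon)$ if $\left|\frac{1}{|X||Y|}\sum_{x\in X,y\in Y}(G(x,y)-q)u(x)v(y)\right|\le\epsilon p$ for all $u:X\to[0,1]$, $v:Y\to[0,1]$. "Of size at least polynomial in $\alpha,\xi,\epsilon'$" means that $c$ and $\epsilon$ may be bounded below by an absolute positive constant times a fixed power of $\alpha\xi\epsilon'$ as these parameters become small. *)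

theory Defs
  imports "HOL-Analysis.Analysis" "Graph_Theory.Digraph_Component"
begin

text \<open>
  A finite simple graph is a \<^locale>\<open>pair_graph\<close>: a finite loop-free digraph without parallel
  arcs whose arc set is symmetric, so that an edge $xy$ is the pair of arcs $(x,y)$, $(y,x)$.
\<close>

definition edge_ind :: "'a pair_pre_digraph \<Rightarrow> 'a \<Rightarrow> 'a \<Rightarrow> real" where
  "edge_ind G x y = (if (x, y) \<in> parcs G then 1 else 0)"

definition nbrs_in :: "'a pair_pre_digraph \<Rightarrow> 'a set \<Rightarrow> 'a \<Rightarrow> 'a set" where
  "nbrs_in G X z = {x \<in> X. (z, x) \<in> parcs G}"

definition tripartite ::
  "'a pair_pre_digraph \<Rightarrow> 'a set \<Rightarrow> 'a set \<Rightarrow> 'a set \<Rightarrow> bool" where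
  "tripartite G X Y Z \<longleftrightarrow>
     pair_graph G \<and> pverts G = X \<union> Y \<union> Z \<and>
     X \<noteq> {} \<and> Y \<noteq> {} \<and> Z \<noteq> {} \<and>
     X \<inter> Y = {} \<and> X \<inter> Z = {} \<and> Y \<inter> Z = {} \<and>
     parcs G \<inter> (X \<times> X \<union> Y \<times> Y \<union> Z \<times> Z) = {}"

text \<open>
  The next two predicates concern the bipartite graph $(X,Y)_G$ that \<open>G\<close> induces between the
  vertex sets \<open>X\<close> and \<open>Y\<close>; they only depend on the values of \<open>edge_ind G\<close> on \<open>X \<times> Y\<close>.
\<close>

definition jumbled ::
  "'a pair_pre_digraph \<Rightarrow> 'a set \<Rightarrow> 'a set \<Rightarrow> real \<Rightarrow> real \<Rightarrow> bool" where
  "jumbled G X Y p \<beta> \<longleftrightarrow>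
     (\<forall>u \<in> X \<rightarrow> {0..1}. \<forall>v \<in> Y \<rightarrow> {0..1}.
        \<bar>\<Sum>x\<in>X. \<Sum>y\<in>Y. (edge_ind G x y - p) * u x * v y\<bar>
          \<le> \<beta> * sqrt (\<Sum>x\<in>X. u x) * sqrt (\<Sum>y\<in>Y. v y))"

text \<open>
  If \<open>X\<close> or \<open>Y\<close> is empty, \<open>DISC\<close> holds for every $\epsilon p \ge 0$, since the sum vanishes.
\<close>

definition DISC ::
  "'a pair_pre_digraph \<Rightarrow> 'a set \<Rightarrow> 'a set \<Rightarrow> real \<Rightarrow> real \<Rightarrow> real \<Rightarrow> bool" where
  "DISC G X Y q p \<epsilon> \<longleftrightarrow>
     (\<forall>u \<in> X \<rightarrow> {0..1}. \<forall>v \<in> Y \<rightarrow> {0..1}.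
        \<bar>1 / (real (card X) * real (card Y)) *
           (\<Sum>x\<in>X. \<Sum>y\<in>Y. (edge_ind G x y - q) * u x * v y)\<bar> \<le> \<epsilon> * p)"

end

theory Submission
  imports Defs
begin

text \<open>
  Write $f = G - q_{XY}$ on $X \times Y$. If many $z$ are bad, the functions witnessing the failure
  of \<open>DISC\<close> between the neighbourhoods of these $z$ combine to weights $|a| \le \Gamma_{XZ}$,
  $|b| \le \Gamma_{YZ}$ for which $T = \sum f(x,y)\,a(x,z)\,b(y,z)$ has order $p^3|X||Y||Z|$, so it
  suffices to bound all such sums. By Cauchy-Schwarz and the jumbledness of $(Y,Z)_\Gamma$, $T$ is
  controlled by $\sum h^2$ with $h(y,z) = \sum_x f(x,y)\,a(x,z)$. As $|h|$ rarely exceeds $2p^2|X|$,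
  this is about $p^2|X| \sum h w$ with $|w| \le 1$: the sparse weight $b$ has been replaced by the
  dense weight $w$. The same step, with the jumbledness of $(X,Z)_\Gamma$, replaces $a$ by a
  dense weight, and then \<open>DISC\<close> of $(X,Y)_G$ applies for each fixed $z$.
\<close>

subsection \<open>Jumbled kernels\<close>

text \<open>The kernel stands for a deviation such as \<open>edge_ind G x y - p\<close>. With the
  mean already subtracted and two independent index types, the sides can be interchanged and one
  bound serves all three pairs.\<close>

definition jumbled_form :: "('s \<Rightarrow> 't \<Rightarrow> real) \<Rightarrow> 's set \<Rightarrow> 't set \<Rightarrow> real \<Rightarrow> bool" where
  "jumbled_form k S T B \<longleftrightarrow>
     (\<forall>u \<in> S \<rightarrow> {0..1}. \<forall>v \<in> T \<rightarrow> {0..1}.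
        \<bar>\<Sum>s\<in>S. \<Sum>t\<in>T. k s t * u s * v t\<bar> \<le> B * sqrt (sum u S) * sqrt (sum v T))"

lemma jumbled_form_flip:
  assumes "jumbled_form k S T B"
  shows "jumbled_form (\<lambda>t s. k s t) T S B"
  unfolding jumbled_form_def
proof (intro ballI)
  fix u v assume "u \<in> T \<rightarrow> {0..1::real}" "v \<in> S \<rightarrow> {0..1::real}"
  then have "\<bar>\<Sum>s\<in>S. \<Sum>t\<in>T. k s t * v s * u t\<bar> \<le> B * sqrt (sum v S) * sqrt (sum u T)"
    using assms unfolding jumbled_form_def by blast
  moreover have "(\<Sum>t\<in>T. \<Sum>s\<in>S. k s t * u t * v s) = (\<Sum>s\<in>S. \<Sum>t\<in>T. k s t * v s * u t)"
    by (subst sum.swap) (simp add: mult_ac)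
  ultimately show "\<bar>\<Sum>t\<in>T. \<Sum>s\<in>S. k s t * u t * v s\<bar> \<le> B * sqrt (sum u T) * sqrt (sum v S)"
    by (simp add: mult_ac)
qed

text \<open>Splitting \<open>u\<close> and \<open>v\<close> into positive and negative parts gives
  four sums with nonnegative weights below \<open>\<bar>u\<bar>\<close> and
  \<open>\<bar>v\<bar>\<close>, hence the factor 4. This passes from test functions with values in
  [0,1] to signed ones.\<close>

lemma bilinear_signed_bound:
  fixes k :: "'s \<Rightarrow> 't \<Rightarrow> real"
  assumes "\<And>u' v'. (\<And>s. 0 \<le> u' s \<and> u' s \<le> \<bar>u s\<bar>) \<Longrightarrow> (\<And>t. 0 \<le> v' t \<and> v' t \<le> \<bar>v t\<bar>) \<Longrightarrow>
             \<bar>\<Sum>s\<in>S. \<Sum>t\<in>T. k s t * u' s * v' t\<bar> \<le> D"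
  shows "\<bar>\<Sum>s\<in>S. \<Sum>t\<in>T. k s t * u s * v t\<bar> \<le> 4 * D"
proof -
  define Q where "Q u v = (\<Sum>s\<in>S. \<Sum>t\<in>T. k s t * u s * v t)" for u v
  define up un where "up s = max 0 (u s)" and "un s = max 0 (- u s)" for s
  define vp vn where "vp t = max 0 (v t)" and "vn t = max 0 (- v t)" for t
  have u: "u s = up s - un s" for s by (simp add: up_def un_def max_def)
  have v: "v t = vp t - vn t" for t by (simp add: vp_def vn_def max_def)
  have "Q u v = Q up vp - Q up vn - Q un vp + Q un vn"
    unfolding Q_def u v by (simp add: algebra_simps sum.distrib sum_subtractf)
  moreover have "\<bar>Q up vp\<bar> \<le> D" "\<bar>Q up vn\<bar> \<le> D" "\<bar>Q un vp\<bar> \<le> D" "\<bar>Q un vn\<bar> \<le> D"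
    unfolding Q_def by (auto intro!: assms simp: up_def un_def vp_def vn_def)
  ultimately show ?thesis unfolding Q_def by linarith
qed

text \<open>Positive and negative parts have sums at most those of the absolute values. Keeping
  these sums, instead of the sizes of \<open>S\<close> and \<open>T\<close>, makes the bound
  summable over many pairs of weights.\<close>

lemma jumbled_form_signed:
  assumes "jumbled_form k S T B" "0 \<le> B"
    and u: "\<And>s. s \<in> S \<Longrightarrow> \<bar>u s\<bar> \<le> 1" and v: "\<And>t. t \<in> T \<Longrightarrow> \<bar>v t\<bar> \<le> 1"
  shows "\<bar>\<Sum>s\<in>S. \<Sum>t\<in>T. k s t * u s * v t\<bar> \<le>
           4 * (B * sqrt (\<Sum>s\<in>S. \<bar>u s\<bar>) * sqrt (\<Sum>t\<in>T. \<bar>v t\<bar>))"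
proof (rule bilinear_signed_bound)
  fix u' v'
  assume u': "\<And>s. 0 \<le> u' s \<and> u' s \<le> \<bar>u s\<bar>" and v': "\<And>t. 0 \<le> v' t \<and> v' t \<le> \<bar>v t\<bar>"
  have "u' \<in> S \<rightarrow> {0..1}" "v' \<in> T \<rightarrow> {0..1}"
    using u v u' v' by (fastforce intro: order_trans)+
  then have "\<bar>\<Sum>s\<in>S. \<Sum>t\<in>T. k s t * u' s * v' t\<bar> \<le> B * sqrt (sum u' S) * sqrt (sum v' T)"
    using assms(1) unfolding jumbled_form_def by blast
  also have "\<dots> \<le> B * sqrt (\<Sum>s\<in>S. \<bar>u s\<bar>) * sqrt (\<Sum>t\<in>T. \<bar>v t\<bar>)"
    using u' v' assms(2)
    by (intro mult_mono real_sqrt_le_mono sum_mono mult_nonneg_nonneg)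
       (auto intro!: sum_nonneg)
  finally show "\<bar>\<Sum>s\<in>S. \<Sum>t\<in>T. k s t * u' s * v' t\<bar> \<le>
    B * sqrt (\<Sum>s\<in>S. \<bar>u s\<bar>) * sqrt (\<Sum>t\<in>T. \<bar>v t\<bar>)" .
qed

text \<open>The excess is itself a multiple of a test function, so one application of the jumbled
  bound controls its second moment.\<close>

lemma excess_second_moment:
  fixes k :: "'s \<Rightarrow> 't \<Rightarrow> real"
  assumes fin: "finite S" "finite T" and jf: "jumbled_form k S T (B * sqrt (card S * card T))"
    and B: "0 \<le> B" and k1: "\<And>s t. s \<in> S \<Longrightarrow> t \<in> T \<Longrightarrow> k s t \<le> 1"
    and v: "v \<in> T \<rightarrow> {0..1}"
  shows "(\<Sum>s\<in>S. (max 0 (\<Sum>t\<in>T. k s t * v t))\<^sup>2) \<le> B * card S * (real (card T))\<^sup>2"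
proof (cases "T = {}")
  case False
  define n where "n = real (card T)"
  have n: "n > 0" using False fin by (simp add: n_def card_gt_0_iff)
  define e where "e s = max 0 (\<Sum>t\<in>T. k s t * v t)" for s
  \<comment> \<open>As \<open>k\<close> and \<open>v\<close> are at most 1, the excess is at most
    \<open>n\<close>, so \<open>u\<close> is an admissible test function.\<close>
  define u where "u s = e s / n" for s
  have "(\<Sum>t\<in>T. k s t * v t) \<le> n" if "s \<in> S" for s
  proof -
    have "k s t * v t \<le> 1" if "t \<in> T" for t
    proof -
      have "v t \<in> {0..1}" using v that by auto
      then have "k s t * v t \<le> 1 * v t"
        using k1[OF \<open>s \<in> S\<close> that] by (intro mult_right_mono) auto
      with \<open>v t \<in> {0..1}\<close> show ?thesis by simp
    qed
    then show ?thesis unfolding n_def using sum_bounded_above[of T "\<lambda>t. k s t * v t" 1] by simp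
  qed
  then have u01: "u \<in> S \<rightarrow> {0..1}" using n by (auto simp: u_def e_def)
  \<comment> \<open>\<open>e s\<close> vanishes where the inner sum is negative, so one factor of
    the square may be replaced by the sum itself.\<close>
  have "(e s)\<^sup>2 = n * (\<Sum>t\<in>T. k s t * u s * v t)" for s
  proof -
    have "(e s)\<^sup>2 = e s * (\<Sum>t\<in>T. k s t * v t)"
      by (simp add: e_def max_def power2_eq_square)
    also have "\<dots> = n * (\<Sum>t\<in>T. k s t * u s * v t)"
      using n by (simp add: u_def sum_distrib_left mult_ac)
    finally show ?thesis .
  qed
  then have "(\<Sum>s\<in>S. (e s)\<^sup>2) = n * (\<Sum>s\<in>S. \<Sum>t\<in>T. k s t * u s * v t)"
    by (simp add: sum_distrib_left)
  also have "\<dots> \<le> n * (B * sqrt (card S * card T) * sqrt (sum u S) * sqrt (sum v T))"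
    using jf u01 v n unfolding jumbled_form_def by (intro mult_left_mono) (auto intro: order_trans abs_ge_self)
  also have "\<dots> \<le> n * (B * sqrt (card S * card T) * sqrt (card S) * sqrt (card T))"
  proof -
    have "sum u S \<le> card S" using sum_bounded_above[of S u 1] u01 by (auto simp: Pi_iff)
    moreover have "sum v T \<le> card T" using sum_bounded_above[of T v 1] v by (auto simp: Pi_iff)
    moreover have "0 \<le> sum u S" "0 \<le> sum v T" using u01 v by (force intro!: sum_nonneg)+
    ultimately show ?thesis using n B
      by (intro mult_left_mono mult_mono real_sqrt_le_mono mult_nonneg_nonneg) auto
  qed
  also have "\<dots> = n * B * (sqrt (card S))\<^sup>2 * (sqrt (card T))\<^sup>2"
    by (simp only: of_nat_mult real_sqrt_mult power2_eq_square mult_ac)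
  also have "\<dots> = B * card S * (real (card T))\<^sup>2"
    by (simp add: n_def power2_eq_square)
  finally show ?thesis unfolding e_def .
qed (use B in simp)

text \<open>A row sum is at most \<open>(p + q) * n\<close> plus the excess of \<open>k\<close> over
  \<open>p\<close>, whose second moment is of order \<open>p\<^sup>2\<close> because
  \<open>B \<le> p\<^sup>2\<close>. The shift \<open>q\<close> makes room for majorants of the form
  \<open>k + p\<close>.\<close>

lemma degree_second_moment:
  fixes k :: "'s \<Rightarrow> 't \<Rightarrow> real"
  assumes fin: "finite S" "finite T"
    and jf: "jumbled_form (\<lambda>s t. k s t - p) S T (B * sqrt (card S * card T))"
    and B: "0 \<le> B" "B \<le> p\<^sup>2" and p: "0 \<le> p" and q: "0 \<le> q"
    and k01: "\<And>s t. s \<in> S \<Longrightarrow> t \<in> T \<Longrightarrow> k s t \<in> {0..1}"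
  shows "(\<Sum>s\<in>S. (\<Sum>t\<in>T. k s t + q)\<^sup>2) \<le> (2 * (p + q)\<^sup>2 + 2 * p\<^sup>2) * (real (card T))\<^sup>2 * card S"
proof -
  define n where "n = real (card T)"
  define e where "e s = max 0 (\<Sum>t\<in>T. (k s t - p) * 1)" for s
  have k1: "k s t - p \<le> 1" if "s \<in> S" "t \<in> T" for s t
    using k01[OF that] p by simp
  have "(\<Sum>s\<in>S. (e s)\<^sup>2) \<le> B * card S * (real (card T))\<^sup>2"
    unfolding e_def using fin jf B(1) k1 by (intro excess_second_moment) auto
  also have "\<dots> \<le> p\<^sup>2 * card S * (real (card T))\<^sup>2"
    using B by (intro mult_right_mono) auto
  finally have e: "(\<Sum>s\<in>S. (e s)\<^sup>2) \<le> p\<^sup>2 * card S * n\<^sup>2" by (simp add: n_def)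
  have "(\<Sum>t\<in>T. k s t + q)\<^sup>2 \<le> 2 * (p + q)\<^sup>2 * n\<^sup>2 + 2 * (e s)\<^sup>2" if "s \<in> S" for s
  proof -
    have "(\<Sum>t\<in>T. k s t + q) \<le> (p + q) * n + e s"
      by (simp add: e_def n_def sum.distrib sum_subtractf algebra_simps max_def)
    moreover have "0 \<le> (\<Sum>t\<in>T. k s t + q)" using k01 that q by (force intro!: sum_nonneg)
    ultimately have "(\<Sum>t\<in>T. k s t + q)\<^sup>2 \<le> ((p + q) * n + e s)\<^sup>2" by (rule power_mono)
    also have "\<dots> \<le> 2 * (p + q)\<^sup>2 * n\<^sup>2 + 2 * (e s)\<^sup>2"
      using zero_le_power2[of "(p + q) * n - e s"] by (simp add: power2_eq_square algebra_simps)
    finally show ?thesis .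
  qed
  then have "(\<Sum>s\<in>S. (\<Sum>t\<in>T. k s t + q)\<^sup>2) \<le> (\<Sum>s\<in>S. 2 * (p + q)\<^sup>2 * n\<^sup>2 + 2 * (e s)\<^sup>2)"
    by (rule sum_mono)
  also have "\<dots> = 2 * (p + q)\<^sup>2 * n\<^sup>2 * card S + 2 * (\<Sum>s\<in>S. (e s)\<^sup>2)"
    by (simp add: sum.distrib sum_distrib_left)
  also have "\<dots> \<le> 2 * (p + q)\<^sup>2 * n\<^sup>2 * card S + 2 * (p\<^sup>2 * card S * n\<^sup>2)"
    using e by simp
  finally show ?thesis by (simp add: n_def algebra_simps)
qed

text \<open>Clipping \<open>h / M\<close> to [-1,1] gives \<open>w\<close>. Where
  \<open>\<bar>h\<bar> \<le> M\<close> the square equals \<open>M * (h * w)\<close>; elsewhere it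
  exceeds this by \<open>\<bar>h\<bar> * (\<bar>h\<bar> - M)\<close>, at most
  \<open>(M + e) * e\<close>, which is small on average. A second moment thus becomes a correlation
  with a bounded weight.\<close>

lemma truncated_second_moment:
  fixes h e :: "'i \<Rightarrow> real"
  assumes fin: "finite I" and M: "0 < M" and E: "0 \<le> E" "E \<le> 1"
    and h: "\<And>i. i \<in> I \<Longrightarrow> \<bar>h i\<bar> \<le> M + e i" and e0: "\<And>i. i \<in> I \<Longrightarrow> 0 \<le> e i"
    and e2: "(\<Sum>i\<in>I. (e i)\<^sup>2) \<le> (E * M)\<^sup>2 * card I"
  obtains w where "\<And>i. \<bar>w i\<bar> \<le> 1"
    "(\<Sum>i\<in>I. (h i)\<^sup>2) \<le> M * (\<Sum>i\<in>I. h i * w i) + 2 * E * M\<^sup>2 * card I"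
proof
  define w where "w i = max (-1) (min 1 (h i / M))" for i
  show "\<bar>w i\<bar> \<le> 1" for i by (simp add: w_def)
  have pt: "(h i)\<^sup>2 \<le> M * (h i * w i) + M * e i + (e i)\<^sup>2" if i: "i \<in> I" for i
  proof -
    have h': "\<bar>h i\<bar> \<le> M + e i" "0 \<le> e i" using h e0 i by auto
    show ?thesis
    proof (cases "\<bar>h i\<bar> \<le> M")
      case True
      then have "w i = h i / M" using M by (auto simp: w_def max_def min_def abs_le_iff field_simps)
      then show ?thesis using M h' by (simp add: power2_eq_square)
    next
      case False
      have "M * (h i * w i) = M * \<bar>h i\<bar>"
      proof (cases "h i > 0")
        case True
        then have "w i = 1" using False M by (simp add: w_def min_def)
        then show ?thesis using True by simp
      next
        case hneg: False
        then have "h i / M < - 1" using False M by (simp add: field_simps)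
        then have "w i = - 1" by (simp add: w_def)
        then show ?thesis using hneg by simp
      qed
      moreover have "(h i)\<^sup>2 - M * \<bar>h i\<bar> = \<bar>h i\<bar> * (\<bar>h i\<bar> - M)"
        by (simp add: power2_eq_square right_diff_distrib)
      moreover have "\<bar>h i\<bar> * (\<bar>h i\<bar> - M) \<le> (M + e i) * e i"
        using h' False M by (intro mult_mono) auto
      ultimately have "(h i)\<^sup>2 \<le> M * (h i * w i) + (M + e i) * e i" by linarith
      then show ?thesis by (simp add: power2_eq_square algebra_simps)
    qed
  qed
  \<comment> \<open>Cauchy-Schwarz against the constant 1 turns the second-moment bound on
    \<open>e\<close> into a bound on its sum.\<close>
  have "(\<Sum>i\<in>I. e i)\<^sup>2 \<le> (\<Sum>i\<in>I. (e i)\<^sup>2) * (\<Sum>i\<in>I. 1\<^sup>2)"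
    using Cauchy_Schwarz_ineq_sum[of e "\<lambda>_. 1" I] by simp
  also have "\<dots> \<le> (E * M)\<^sup>2 * card I * card I"
    using e2 by (simp add: mult_right_mono)
  finally have "(\<Sum>i\<in>I. e i)\<^sup>2 \<le> (E * M * card I)\<^sup>2" by (simp add: power2_eq_square mult_ac)
  then have e1: "(\<Sum>i\<in>I. e i) \<le> E * M * card I"
    by (rule power2_le_imp_le) (use E M in simp)
  have "(\<Sum>i\<in>I. (h i)\<^sup>2) \<le> (\<Sum>i\<in>I. M * (h i * w i) + M * e i + (e i)\<^sup>2)"
    by (rule sum_mono) (rule pt)
  also have "\<dots> = M * (\<Sum>i\<in>I. h i * w i) + M * (\<Sum>i\<in>I. e i) + (\<Sum>i\<in>I. (e i)\<^sup>2)"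
    by (simp add: sum.distrib sum_distrib_left)
  also have "\<dots> \<le> M * (\<Sum>i\<in>I. h i * w i) + M * (E * M * card I) + (E * M)\<^sup>2 * card I"
    using e1 e2 M by (intro add_mono mult_left_mono) auto
  \<comment> \<open>\<open>E \<le> 1\<close> turns the quadratic error into a second copy of the
    linear one.\<close>
  also have "(E * M)\<^sup>2 * card I \<le> E * M\<^sup>2 * card I"
    using mult_right_mono[of E 1 "E * M\<^sup>2"] E
    by (intro mult_right_mono) (simp_all add: power2_eq_square mult_ac)
  finally show "(\<Sum>i\<in>I. (h i)\<^sup>2) \<le> M * (\<Sum>i\<in>I. h i * w i) + 2 * E * M\<^sup>2 * card I"
    by (simp add: power2_eq_square algebra_simps)
qed

lemma sum_sqrt_mult_le:
  fixes P Q :: "'i \<Rightarrow> real"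
  assumes "\<And>i. i \<in> I \<Longrightarrow> 0 \<le> P i" "\<And>i. i \<in> I \<Longrightarrow> 0 \<le> Q i"
  shows "(\<Sum>i\<in>I. sqrt (P i) * sqrt (Q i)) \<le> sqrt (sum P I) * sqrt (sum Q I)"
proof -
  have "(\<Sum>i\<in>I. sqrt (P i) * sqrt (Q i))\<^sup>2 \<le> (\<Sum>i\<in>I. (sqrt (P i))\<^sup>2) * (\<Sum>i\<in>I. (sqrt (Q i))\<^sup>2)"
    by (rule Cauchy_Schwarz_ineq_sum)
  also have "\<dots> = sum P I * sum Q I" using assms by simp
  finally show ?thesis by (simp add: real_le_rsqrt flip: real_sqrt_mult)
qed

text \<open>Cauchy-Schwarz against the sparse majorant \<open>k\<close>; then \<open>k\<close> is replaced by its mean \<open>p\<close>, at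
  the cost of a jumbledness error for each pair \<open>r, r'\<close> arising from the square.\<close>

lemma sparse_Cauchy_Schwarz:
  fixes k :: "'s \<Rightarrow> 't \<Rightarrow> real" and f :: "'r \<Rightarrow> 's \<Rightarrow> real" and g :: "'r \<Rightarrow> 't \<Rightarrow> real"
    and F G :: real
  assumes fin: "finite S" "finite T" "finite R"
    and jf: "jumbled_form (\<lambda>s t. k s t - p) S T (B * sqrt (card S * card T))"
    and B: "0 \<le> B" "B \<le> p"
    and k0: "\<And>s t. s \<in> S \<Longrightarrow> t \<in> T \<Longrightarrow> 0 \<le> k s t"
    and a: "\<And>s t. s \<in> S \<Longrightarrow> t \<in> T \<Longrightarrow> \<bar>a s t\<bar> \<le> k s t"
    and f1: "\<And>r s. r \<in> R \<Longrightarrow> s \<in> S \<Longrightarrow> \<bar>f r s\<bar> \<le> 1"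
    and g1: "\<And>r t. r \<in> R \<Longrightarrow> t \<in> T \<Longrightarrow> \<bar>g r t\<bar> \<le> 1"
    and F: "0 \<le> F" "(\<Sum>s\<in>S. (\<Sum>r\<in>R. \<bar>f r s\<bar>)\<^sup>2) \<le> F\<^sup>2 * card S"
    and G: "0 \<le> G" "(\<Sum>t\<in>T. (\<Sum>r\<in>R. \<bar>g r t\<bar>)\<^sup>2) \<le> G\<^sup>2 * card T"
  shows "(\<Sum>s\<in>S. \<Sum>t\<in>T. a s t * (\<Sum>r\<in>R. f r s * g r t))\<^sup>2 \<le>
    2 * p * card S * card T *
      (p * (\<Sum>s\<in>S. \<Sum>t\<in>T. (\<Sum>r\<in>R. f r s * g r t)\<^sup>2) + 4 * B * F * G * card S * card T)"
proof -
  define h where "h s t = (\<Sum>r\<in>R. f r s * g r t)" for s t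
  define b where "b = B * sqrt (card S * card T)"
  have b0: "0 \<le> b" using B by (simp add: b_def)
  \<comment> \<open>Constant test functions bound the total mass of \<open>k\<close>;
    \<open>B \<le> p\<close> then gives the factor 2.\<close>
  have "\<bar>\<Sum>s\<in>S. \<Sum>t\<in>T. (k s t - p) * 1 * 1\<bar> \<le> b * sqrt (\<Sum>s\<in>S. 1) * sqrt (\<Sum>t\<in>T. 1)"
    using jf unfolding jumbled_form_def b_def by fastforce
  also have "\<dots> = B * (sqrt (card S))\<^sup>2 * (sqrt (card T))\<^sup>2"
    by (simp add: b_def real_sqrt_mult power2_eq_square mult_ac del: real_sqrt_mult_self)
  also have "\<dots> = B * card S * card T" by simp
  finally have "(\<Sum>s\<in>S. \<Sum>t\<in>T. k s t) \<le> (p + B) * card S * card T"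
    by (simp add: sum_subtractf algebra_simps)
  also have "\<dots> \<le> 2 * p * card S * card T" using B by (intro mult_right_mono) auto
  finally have K: "(\<Sum>s\<in>S. \<Sum>t\<in>T. k s t) \<le> 2 * p * card S * card T" .

  \<comment> \<open>Expanding the square over pairs \<open>(r, r')\<close> separates the variables:
    each term is a function of \<open>s\<close> times a function of \<open>t\<close>, to which the
    signed jumbled bound applies.\<close>
  have "(\<Sum>s\<in>S. \<Sum>t\<in>T. (k s t - p) * (h s t)\<^sup>2) =
      (\<Sum>s\<in>S. \<Sum>t\<in>T. \<Sum>(r,r')\<in>R\<times>R. (k s t - p) * (f r s * f r' s) * (g r t * g r' t))"
    by (simp add: h_def power2_eq_square sum_product sum_distrib_left mult_ac
          flip: sum.cartesian_product)
  also have "\<dots> = (\<Sum>s\<in>S. \<Sum>(r,r')\<in>R\<times>R. \<Sum>t\<in>T. (k s t - p) * (f r s * f r' s) * (g r t * g r' t))"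
    by (subst sum.swap) (simp add: case_prod_unfold)
  also have "\<dots> = (\<Sum>(r,r')\<in>R\<times>R. \<Sum>s\<in>S. \<Sum>t\<in>T. (k s t - p) * (f r s * f r' s) * (g r t * g r' t))"
    by (subst sum.swap) (simp add: case_prod_unfold)
  also have "\<dots> \<le> (\<Sum>(r,r')\<in>R\<times>R. 4 * b * (sqrt (\<Sum>s\<in>S. \<bar>f r s * f r' s\<bar>) * sqrt (\<Sum>t\<in>T. \<bar>g r t * g r' t\<bar>)))"
  proof (rule sum_mono, clarify)
    fix r r' assume "r \<in> R" "r' \<in> R"
    then have "\<bar>f r s * f r' s\<bar> \<le> 1" if "s \<in> S" for s
      using f1 that by (simp add: abs_mult mult_le_one)
    moreover have "\<bar>g r t * g r' t\<bar> \<le> 1" if "t \<in> T" for t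
      using g1 that \<open>r \<in> R\<close> \<open>r' \<in> R\<close> by (simp add: abs_mult mult_le_one)
    ultimately show "(\<Sum>s\<in>S. \<Sum>t\<in>T. (k s t - p) * (f r s * f r' s) * (g r t * g r' t)) \<le>
        4 * b * (sqrt (\<Sum>s\<in>S. \<bar>f r s * f r' s\<bar>) * sqrt (\<Sum>t\<in>T. \<bar>g r t * g r' t\<bar>))"
      using jumbled_form_signed[OF jf[folded b_def] b0, of "\<lambda>s. f r s * f r' s" "\<lambda>t. g r t * g r' t"]
      by (simp add: mult_ac)
  qed
  also have "\<dots> = 4 * b * (\<Sum>(r,r')\<in>R\<times>R. sqrt (\<Sum>s\<in>S. \<bar>f r s * f r' s\<bar>) * sqrt (\<Sum>t\<in>T. \<bar>g r t * g r' t\<bar>))"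
    by (simp add: sum_distrib_left case_prod_unfold)
  \<comment> \<open>Cauchy-Schwarz over the pairs replaces the sum of products of roots by the roots
    of two full sums. After exchanging the order, each full sum consists of squares of absolute sums
    over \<open>R\<close>, which \<open>F\<close> and \<open>G\<close> control.\<close>
  also have "\<dots> \<le> 4 * b * (sqrt (\<Sum>(r,r')\<in>R\<times>R. \<Sum>s\<in>S. \<bar>f r s * f r' s\<bar>) *
                            sqrt (\<Sum>(r,r')\<in>R\<times>R. \<Sum>t\<in>T. \<bar>g r t * g r' t\<bar>))"
    using sum_sqrt_mult_le[of "R \<times> R" "\<lambda>(r,r'). \<Sum>s\<in>S. \<bar>f r s * f r' s\<bar>" "\<lambda>(r,r'). \<Sum>t\<in>T. \<bar>g r t * g r' t\<bar>"] b0
    by (intro mult_left_mono) (auto simp: case_prod_unfold intro: sum_nonneg)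
  also have "(\<Sum>(r,r')\<in>R\<times>R. \<Sum>s\<in>S. \<bar>f r s * f r' s\<bar>) = (\<Sum>s\<in>S. (\<Sum>r\<in>R. \<bar>f r s\<bar>)\<^sup>2)"
    by (simp add: case_prod_unfold sum.swap[of _ S] power2_eq_square sum_product sum.cartesian_product abs_mult)
  also have "(\<Sum>(r,r')\<in>R\<times>R. \<Sum>t\<in>T. \<bar>g r t * g r' t\<bar>) = (\<Sum>t\<in>T. (\<Sum>r\<in>R. \<bar>g r t\<bar>)\<^sup>2)"
    by (simp add: case_prod_unfold sum.swap[of _ T] power2_eq_square sum_product sum.cartesian_product abs_mult)
  also have "4 * b * (sqrt (\<Sum>s\<in>S. (\<Sum>r\<in>R. \<bar>f r s\<bar>)\<^sup>2) * sqrt (\<Sum>t\<in>T. (\<Sum>r\<in>R. \<bar>g r t\<bar>)\<^sup>2))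
      \<le> 4 * b * (sqrt (F\<^sup>2 * card S) * sqrt (G\<^sup>2 * card T))"
    using F G b0 by (intro mult_left_mono mult_mono real_sqrt_le_mono) (auto intro!: sum_nonneg)
  also have "\<dots> = 4 * B * F * G * (sqrt (card S))\<^sup>2 * (sqrt (card T))\<^sup>2"
    using F(1) G(1)
    by (simp add: b_def real_sqrt_mult power2_eq_square[of "sqrt _"] mult_ac del: real_sqrt_mult_self)
  also have "\<dots> = 4 * B * F * G * card S * card T" by simp
  finally have err: "(\<Sum>s\<in>S. \<Sum>t\<in>T. k s t * (h s t)\<^sup>2) \<le>
      p * (\<Sum>s\<in>S. \<Sum>t\<in>T. (h s t)\<^sup>2) + 4 * B * F * G * card S * card T"
    by (simp add: left_diff_distrib sum_subtractf sum_distrib_left)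

  \<comment> \<open>Writing \<open>k * \<bar>h\<bar>\<close> as
    \<open>sqrt k * sqrt (k * h\<^sup>2)\<close> makes Cauchy-Schwarz leave the mass of
    \<open>k\<close> and the \<open>k\<close>-weighted second moment of \<open>h\<close>.\<close>
  have "\<bar>\<Sum>s\<in>S. \<Sum>t\<in>T. a s t * h s t\<bar> \<le> (\<Sum>(s,t)\<in>S\<times>T. sqrt (k s t) * sqrt (k s t * (h s t)\<^sup>2))"
    unfolding sum.cartesian_product
  proof (rule order_trans[OF sum_abs], rule sum_mono, clarify)
    fix s t assume "s \<in> S" "t \<in> T"
    then have "\<bar>a s t * h s t\<bar> \<le> k s t * \<bar>h s t\<bar>" using a by (simp add: abs_mult mult_right_mono)
    then show "\<bar>a s t * h s t\<bar> \<le> sqrt (k s t) * sqrt (k s t * (h s t)\<^sup>2)"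
      using k0[OF \<open>s \<in> S\<close> \<open>t \<in> T\<close>] by (simp add: real_sqrt_mult flip: mult.assoc)
  qed
  also have "\<dots> \<le> sqrt (\<Sum>(s,t)\<in>S\<times>T. k s t) * sqrt (\<Sum>(s,t)\<in>S\<times>T. k s t * (h s t)\<^sup>2)"
    using sum_sqrt_mult_le[of "S \<times> T" "\<lambda>(s,t). k s t" "\<lambda>(s,t). k s t * (h s t)\<^sup>2"] k0
    by (auto simp: case_prod_unfold)
  finally have "\<bar>\<Sum>s\<in>S. \<Sum>t\<in>T. a s t * h s t\<bar>\<^sup>2 \<le>
      (sqrt (\<Sum>s\<in>S. \<Sum>t\<in>T. k s t) * sqrt (\<Sum>s\<in>S. \<Sum>t\<in>T. k s t * (h s t)\<^sup>2))\<^sup>2"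
    unfolding sum.cartesian_product by (rule power_mono) simp
  also have "\<dots> = (\<Sum>s\<in>S. \<Sum>t\<in>T. k s t) * (\<Sum>s\<in>S. \<Sum>t\<in>T. k s t * (h s t)\<^sup>2)"
    using k0 by (simp add: power_mult_distrib sum_nonneg)
  also have "\<dots> \<le> 2 * p * card S * card T *
      (p * (\<Sum>s\<in>S. \<Sum>t\<in>T. (h s t)\<^sup>2) + 4 * B * F * G * card S * card T)"
    using K err k0 B by (intro mult_mono) (auto intro!: sum_nonneg)
  finally show ?thesis by (simp add: h_def)
qed

subsection \<open>Counting triangles with sparse weights\<close>

text \<open>The kernels stand for the three parts of \<open>\<Gamma>\<close>, and \<open>f\<close>
  for the deviation of \<open>G\<close>. Each of the two Cauchy-Schwarz steps takes a square root,
  so the discrepancy \<open>d^4\<close> becomes \<open>d\<^sup>2\<close> and then \<open>d\<close>.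
  The powers of \<open>p\<close> in the jumbled bounds keep the errors of truncation and of
  replacing a kernel by \<open>p\<close> within the order in \<open>p\<close> of the main
  terms.\<close>

lemma sparse_triangle_count:
  fixes k1 :: "'x \<Rightarrow> 'y \<Rightarrow> real" and k2 :: "'x \<Rightarrow> 'z \<Rightarrow> real" and k3 :: "'y \<Rightarrow> 'z \<Rightarrow> real"
  assumes fin: "finite X" "finite Y" "finite Z" and ne: "X \<noteq> {}" "Y \<noteq> {}"
    and p: "0 < p" "p \<le> 1" and d: "0 < d" "d \<le> 1/2"
    and j1: "jumbled_form (\<lambda>x y. k1 x y - p) X Y (d^8 * p^4 * sqrt (card X * card Y))"
    and j2: "jumbled_form (\<lambda>x z. k2 x z - p) X Z (d^8 * p^2 * sqrt (card X * card Z))"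
    and j3: "jumbled_form (\<lambda>y z. k3 y z - p) Y Z (d^8 * p^3 * sqrt (card Y * card Z))"
    and k1: "\<And>x y. k1 x y \<in> {0..1}" and k2: "\<And>x z. k2 x z \<in> {0..1}"
    and k3: "\<And>y z. 0 \<le> k3 y z"
    and f: "\<And>x y. \<bar>f x y\<bar> \<le> 1" "\<And>x y. \<bar>f x y\<bar> \<le> k1 x y + p"
    and a: "\<And>x z. \<bar>a x z\<bar> \<le> k2 x z" and b: "\<And>y z. \<bar>b y z\<bar> \<le> k3 y z"
    and disc: "\<And>u v. u \<in> X \<rightarrow> {0..1} \<Longrightarrow> v \<in> Y \<rightarrow> {0..1} \<Longrightarrow>
      \<bar>\<Sum>x\<in>X. \<Sum>y\<in>Y. f x y * u x * v y\<bar> \<le> d^4 * p * card X * card Y"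
  shows "\<bar>\<Sum>y\<in>Y. \<Sum>z\<in>Z. b y z * (\<Sum>x\<in>X. f x y * a x z)\<bar> \<le> 12 * d * p^3 * card X * card Y * card Z"
proof -
  define m n l where "m = real (card X)" and "n = real (card Y)" and "l = real (card Z)"
  have pos: "0 < m" "0 < n" "0 \<le> l"
    using fin ne by (auto simp: m_def n_def l_def card_gt_0_iff)
  have d4: "0 < d^4" "d^4 \<le> 1/16" "d^8 = (d^4)\<^sup>2" "d^4 \<le> d\<^sup>2"
    using d power_mono[of d "1/2" 4] power_decreasing[of 2 4 d] by (auto simp: power_divide simp flip: power_mult)
  have d8: "0 < d^8" "d^8 \<le> d^4" "d^8 \<le> 1" "d^8 \<le> d\<^sup>2"
    using d power_decreasing[of 4 8 d] power_decreasing[of 2 8 d] power_le_one[of d 8] by auto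
  have p4: "p^4 \<le> 4 * p\<^sup>2"
    using power_decreasing[of 2 4 p] p zero_le_power2[of p] by linarith
  have B1: "d^8 * p^4 \<le> p\<^sup>2"
    using mult_mono[of "d^8" 1 "p^4" "p\<^sup>2"] power_decreasing[of 2 4 p] d8 p by auto
  have B2: "d^8 * p\<^sup>2 \<le> p\<^sup>2" "d^8 * p\<^sup>2 \<le> p"
    using mult_mono[of "d^8" 1 "p^2" "p\<^sup>2"] mult_mono[of "d^8" 1 "p^2" p] power_decreasing[of 1 2 p] d8 p by auto
  have B3: "d^8 * p^3 \<le> p"
    using mult_mono[of "d^8" 1 "p^3" p] power_decreasing[of 1 3 p] d8 p by auto
  have j1': "jumbled_form (\<lambda>y x. k1 x y - p) Y X (d^8 * p^4 * sqrt (card Y * card X))"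
    using jumbled_form_flip[OF j1] by (simp add: mult_ac)
  have j2': "jumbled_form (\<lambda>z x. k2 x z - p) Z X (d^8 * p^2 * sqrt (card Z * card X))"
    using jumbled_form_flip[OF j2] by (simp add: mult_ac)
  have k1p: "k1 x y - p \<le> 1" and k2p: "k2 x z - p \<le> 1" for x y z
    using k1[of x y] k2[of x z] p by auto

  \<comment> \<open>Size of \<open>h\<close> and its truncation to a dense weight
    \<open>w\<close>\<close>
  define h where "h y z = (\<Sum>x\<in>X. f x y * a x z)" for y z
  \<comment> \<open>Splitting \<open>k1 = (k1 - p) + p\<close> and then
    \<open>k2 = (k2 - p) + p\<close> in the majorant of \<open>h\<close> gives the typical value
    \<open>2 * p\<^sup>2 * m\<close>; \<open>e1\<close> and \<open>e2\<close> collect the two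
    excesses.\<close>
  define e1 where "e1 y z = max 0 (\<Sum>x\<in>X. (k1 x y - p) * k2 x z)" for y z
  define e2 where "e2 z = max 0 (\<Sum>x\<in>X. (k2 x z - p) * 1)" for z
  have h_le: "\<bar>h y z\<bar> \<le> 2 * p\<^sup>2 * m + (e1 y z + 2 * p * e2 z)" for y z
  proof -
    have "\<bar>h y z\<bar> \<le> (\<Sum>x\<in>X. (k1 x y + p) * k2 x z)"
      unfolding h_def using f a k2 k1
      by (intro order_trans[OF sum_abs] sum_mono) (auto simp: abs_mult intro!: mult_mono order_trans[OF abs_ge_zero f(2)])
    also have "\<dots> = (\<Sum>x\<in>X. (k1 x y - p) * k2 x z) + 2 * p * ((\<Sum>x\<in>X. (k2 x z - p) * 1) + p * m)"
      by (simp add: m_def algebra_simps sum.distrib sum_subtractf sum_distrib_left)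
    also have "\<dots> \<le> e1 y z + 2 * p * (e2 z + p * m)"
      using p by (intro add_mono mult_left_mono) (auto simp: e1_def e2_def)
    finally show ?thesis by (simp add: power2_eq_square algebra_simps)
  qed
  \<comment> \<open>For fixed \<open>z\<close> the column \<open>k2 x z\<close> is a test function
    in \<open>x\<close>, so the jumbledness between \<open>X\<close> and \<open>Y\<close> applies to
    every \<open>z\<close> separately.\<close>
  have e1_sq: "(\<Sum>y\<in>Y. (e1 y z)\<^sup>2) \<le> d^8 * p^4 * n * m\<^sup>2" for z
    unfolding e1_def m_def n_def using fin j1' d8 p k1p k2
    by (intro excess_second_moment) auto
  have e2_sq: "(\<Sum>z\<in>Z. (e2 z)\<^sup>2) \<le> d^8 * p\<^sup>2 * l * m\<^sup>2"
    unfolding e2_def m_def l_def using fin j2' d8 p k2p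
    by (intro excess_second_moment) auto
  have "(\<Sum>(y,z)\<in>Y\<times>Z. (e1 y z + 2 * p * e2 z)\<^sup>2) \<le> (\<Sum>(y,z)\<in>Y\<times>Z. 2 * (e1 y z)\<^sup>2 + 8 * p\<^sup>2 * (e2 z)\<^sup>2)"
  proof (rule sum_mono, clarify)
    fix y z
    show "(e1 y z + 2 * p * e2 z)\<^sup>2 \<le> 2 * (e1 y z)\<^sup>2 + 8 * p\<^sup>2 * (e2 z)\<^sup>2"
      using zero_le_power2[of "e1 y z - 2 * p * e2 z"] by (simp add: power2_eq_square algebra_simps)
  qed
  also have "\<dots> = (\<Sum>z\<in>Z. \<Sum>y\<in>Y. 2 * (e1 y z)\<^sup>2 + 8 * p\<^sup>2 * (e2 z)\<^sup>2)"
    by (simp add: sum.swap[of _ Z Y] flip: sum.cartesian_product)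
  also have "\<dots> = 2 * (\<Sum>z\<in>Z. \<Sum>y\<in>Y. (e1 y z)\<^sup>2) + 8 * p\<^sup>2 * n * (\<Sum>z\<in>Z. (e2 z)\<^sup>2)"
    by (simp add: sum.distrib sum_distrib_left n_def mult_ac)
  also have "\<dots> \<le> 2 * (\<Sum>z\<in>Z. d^8 * p^4 * n * m\<^sup>2) + 8 * p\<^sup>2 * n * (d^8 * p\<^sup>2 * l * m\<^sup>2)"
    using e1_sq e2_sq pos by (intro add_mono mult_left_mono sum_mono) auto
  also have "\<dots> = 10 * (d^8 * p^4 * m\<^sup>2 * n * l)"
    by (simp add: l_def eval_nat_numeral algebra_simps)
  \<comment> \<open>Rounding 10 up to 16 gives the square form wanted for truncation, with
    \<open>M = 2 * p\<^sup>2 * m\<close> and \<open>E = 2 * d^4\<close>.\<close>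
  also have "\<dots> \<le> 16 * (d^8 * p^4 * m\<^sup>2 * n * l)"
    using d8 p pos by (intro mult_right_mono) auto
  also have "\<dots> = (2 * d^4 * (2 * p\<^sup>2 * m))\<^sup>2 * real (card (Y \<times> Z))"
    unfolding d4(3) by (simp add: n_def l_def card_cartesian_product power_mult_distrib mult_ac flip: power_mult)
  finally have e_sq: "(\<Sum>i\<in>Y\<times>Z. (case i of (y,z) \<Rightarrow> e1 y z + 2 * p * e2 z)\<^sup>2)
      \<le> (2 * d^4 * (2 * p\<^sup>2 * m))\<^sup>2 * real (card (Y \<times> Z))"
    by (simp add: case_prod_unfold)
  obtain w where w: "\<And>i. \<bar>w i\<bar> \<le> 1" and
    "(\<Sum>i\<in>Y\<times>Z. (case i of (y,z) \<Rightarrow> h y z)\<^sup>2) \<le> 2 * p\<^sup>2 * m * (\<Sum>i\<in>Y\<times>Z. (case i of (y,z) \<Rightarrow> h y z) * w i)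
        + 2 * (2 * d^4) * (2 * p\<^sup>2 * m)\<^sup>2 * real (card (Y \<times> Z))"
    by (rule truncated_second_moment[OF _ _ _ _ _ _ e_sq, of "\<lambda>(y,z). h y z"])
       (use fin pos p d4 h_le in \<open>auto simp: e1_def e2_def\<close>)
  then have h_sq: "(\<Sum>y\<in>Y. \<Sum>z\<in>Z. (h y z)\<^sup>2) \<le> 2 * p\<^sup>2 * m * (\<Sum>y\<in>Y. \<Sum>z\<in>Z. h y z * w (y,z))
        + 16 * d^4 * p^4 * m\<^sup>2 * n * l"
    by (simp add: sum.cartesian_product case_prod_unfold card_cartesian_product n_def l_def
          power_mult_distrib mult_ac flip: power_mult)

  \<comment> \<open>Truncation of \<open>g\<close> and discrepancy with dense weights\<close>
  define g where "g x z = (\<Sum>y\<in>Y. f x y * w (y,z))" for x z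
  define e3 where "e3 x = max 0 (\<Sum>y\<in>Y. (k1 x y - p) * 1)" for x
  \<comment> \<open>\<open>w\<close> is bounded by 1, so \<open>g\<close> is controlled by the
    degree of \<open>x\<close> into \<open>Y\<close>, and the excess \<open>e3\<close> does not
    depend on \<open>z\<close>.\<close>
  have g_le: "\<bar>g x z\<bar> \<le> 2 * p * n + e3 x" for x z
  proof -
    have "\<bar>g x z\<bar> \<le> (\<Sum>y\<in>Y. (k1 x y + p) * 1)"
      unfolding g_def using f w k1
      by (intro order_trans[OF sum_abs] sum_mono) (auto simp only: abs_mult intro!: mult_mono order_trans[OF abs_ge_zero f(2)])
    also have "\<dots> = (\<Sum>y\<in>Y. (k1 x y - p) * 1) + 2 * p * n"
      by (simp add: n_def sum.distrib sum_subtractf)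
    finally show ?thesis by (simp add: e3_def)
  qed
  have e3_sq: "(\<Sum>x\<in>X. (e3 x)\<^sup>2) \<le> d^8 * p^4 * m * n\<^sup>2"
    unfolding e3_def m_def n_def using fin j1 d8 p k1p
    by (intro excess_second_moment) auto
  have "(\<Sum>(x,z)\<in>X\<times>Z. (e3 x)\<^sup>2) = l * (\<Sum>x\<in>X. (e3 x)\<^sup>2)"
    by (simp add: l_def sum_distrib_left flip: sum.cartesian_product)
  also have "\<dots> \<le> l * (d^8 * p^4 * m * n\<^sup>2)" using e3_sq pos by (intro mult_left_mono)
  \<comment> \<open>\<open>4 * p\<^sup>2\<close> is the square of \<open>2 * p\<close>, which fits
    the truncation level \<open>2 * p * n\<close> with \<open>E = d^4\<close>.\<close>
  also have "\<dots> \<le> l * (d^8 * (4 * p\<^sup>2) * m * n\<^sup>2)"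
    using d8 p4 pos by (intro mult_left_mono mult_right_mono) auto
  also have "\<dots> = (d^4 * (2 * p * n))\<^sup>2 * real (card (X \<times> Z))"
    unfolding d4(3) by (simp add: m_def l_def card_cartesian_product power_mult_distrib mult_ac)
  finally have e3_sq': "(\<Sum>i\<in>X\<times>Z. (case i of (x,z) \<Rightarrow> e3 x)\<^sup>2)
      \<le> (d^4 * (2 * p * n))\<^sup>2 * real (card (X \<times> Z))"
    by (simp add: case_prod_unfold)
  obtain v where v: "\<And>i. \<bar>v i\<bar> \<le> 1" and
    "(\<Sum>i\<in>X\<times>Z. (case i of (x,z) \<Rightarrow> g x z)\<^sup>2) \<le> 2 * p * n * (\<Sum>i\<in>X\<times>Z. (case i of (x,z) \<Rightarrow> g x z) * v i)
        + 2 * d^4 * (2 * p * n)\<^sup>2 * real (card (X \<times> Z))"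
    by (rule truncated_second_moment[OF _ _ _ _ _ _ e3_sq', of "\<lambda>(x,z). g x z"])
       (use fin pos p d4 g_le in \<open>auto simp: e3_def\<close>)
  then have "(\<Sum>x\<in>X. \<Sum>z\<in>Z. (g x z)\<^sup>2) \<le> 2 * p * n * (\<Sum>x\<in>X. \<Sum>z\<in>Z. g x z * v (x,z))
        + 8 * d^4 * p\<^sup>2 * n\<^sup>2 * m * l"
    by (simp add: sum.cartesian_product case_prod_unfold card_cartesian_product m_def l_def
          power_mult_distrib mult_ac)
  also have "(\<Sum>x\<in>X. \<Sum>z\<in>Z. g x z * v (x,z)) = (\<Sum>z\<in>Z. \<Sum>x\<in>X. \<Sum>y\<in>Y. f x y * v (x,z) * w (y,z))"
    by (subst sum.swap) (simp add: g_def sum_distrib_right sum_distrib_left mult_ac)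
  \<comment> \<open>For fixed \<open>z\<close> both \<open>v\<close> and \<open>w\<close> are dense
    weights, so the discrepancy hypothesis applies; the factor 4 comes from their signs.\<close>
  also have "\<dots> \<le> (\<Sum>z\<in>Z. 4 * (d^4 * p * m * n))"
  proof (rule sum_mono)
    fix z
    have "\<bar>\<Sum>x\<in>X. \<Sum>y\<in>Y. f x y * v (x,z) * w (y,z)\<bar> \<le> 4 * (d^4 * p * m * n)"
    proof (rule bilinear_signed_bound)
      fix u' v'
      assume u': "\<And>x. 0 \<le> u' x \<and> u' x \<le> \<bar>v (x,z)\<bar>" and v': "\<And>y. 0 \<le> v' y \<and> v' y \<le> \<bar>w (y,z)\<bar>"
      show "\<bar>\<Sum>x\<in>X. \<Sum>y\<in>Y. f x y * u' x * v' y\<bar> \<le> d^4 * p * m * n"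
        unfolding m_def n_def
      proof (rule disc)
        show "u' \<in> X \<rightarrow> {0..1}" using u' order_trans[OF _ v] by (metis Pi_I atLeastAtMost_iff)
        show "v' \<in> Y \<rightarrow> {0..1}" using v' order_trans[OF _ w] by (metis Pi_I atLeastAtMost_iff)
      qed
    qed
    then show "(\<Sum>x\<in>X. \<Sum>y\<in>Y. f x y * v (x,z) * w (y,z)) \<le> 4 * (d^4 * p * m * n)" by linarith
  qed
  also have "2 * p * n * (\<Sum>z\<in>Z. 4 * (d^4 * p * m * n)) + 8 * d^4 * p\<^sup>2 * n\<^sup>2 * m * l = 16 * d^4 * p\<^sup>2 * n\<^sup>2 * m * l"
    by (simp add: l_def power2_eq_square)
  finally have g_sq: "(\<Sum>x\<in>X. \<Sum>z\<in>Z. (g x z)\<^sup>2) \<le> 16 * d^4 * p\<^sup>2 * n\<^sup>2 * m * l"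
    using p pos by simp

  \<comment> \<open>Second moments of the absolute row sums\<close>
  have fX: "(\<Sum>x\<in>X. (\<Sum>y\<in>Y. \<bar>f x y\<bar>)\<^sup>2) \<le> (4 * p * n)\<^sup>2 * card X"
  proof -
    have "(\<Sum>x\<in>X. (\<Sum>y\<in>Y. \<bar>f x y\<bar>)\<^sup>2) \<le> (\<Sum>x\<in>X. (\<Sum>y\<in>Y. k1 x y + p)\<^sup>2)"
      using f by (intro sum_mono power_mono) (auto intro: sum_nonneg)
    also have "\<dots> \<le> (2 * (p + p)\<^sup>2 + 2 * p\<^sup>2) * (real (card Y))\<^sup>2 * card X"
      using fin j1 B1 d8 p k1 by (intro degree_second_moment) auto
    \<comment> \<open>The first factor is \<open>10 * p\<^sup>2\<close>, rounded up to the square of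
      \<open>4 * p\<close>.\<close>
    also have "\<dots> \<le> (16 * p\<^sup>2) * (real (card Y))\<^sup>2 * card X"
      by (intro mult_right_mono) (auto simp: power2_eq_square)
    finally show ?thesis by (simp add: n_def power_mult_distrib)
  qed
  have fY: "(\<Sum>y\<in>Y. (\<Sum>x\<in>X. \<bar>f x y\<bar>)\<^sup>2) \<le> (4 * p * m)\<^sup>2 * card Y"
  proof -
    have "(\<Sum>y\<in>Y. (\<Sum>x\<in>X. \<bar>f x y\<bar>)\<^sup>2) \<le> (\<Sum>y\<in>Y. (\<Sum>x\<in>X. k1 x y + p)\<^sup>2)"
      using f by (intro sum_mono power_mono) (auto intro: sum_nonneg)
    also have "\<dots> \<le> (2 * (p + p)\<^sup>2 + 2 * p\<^sup>2) * (real (card X))\<^sup>2 * card Y"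
      using fin j1' B1 d8 p k1 by (intro degree_second_moment) auto
    also have "\<dots> \<le> (16 * p\<^sup>2) * (real (card X))\<^sup>2 * card Y"
      by (intro mult_right_mono) (auto simp: power2_eq_square)
    finally show ?thesis by (simp add: m_def power_mult_distrib)
  qed
  have aZ: "(\<Sum>z\<in>Z. (\<Sum>x\<in>X. \<bar>a x z\<bar>)\<^sup>2) \<le> (2 * p * m)\<^sup>2 * card Z"
  proof -
    have "(\<Sum>z\<in>Z. (\<Sum>x\<in>X. \<bar>a x z\<bar>)\<^sup>2) \<le> (\<Sum>z\<in>Z. (\<Sum>x\<in>X. k2 x z + 0)\<^sup>2)"
      using a by (intro sum_mono power_mono) (auto intro: sum_nonneg)
    also have "\<dots> \<le> (2 * (p + 0)\<^sup>2 + 2 * p\<^sup>2) * (real (card X))\<^sup>2 * card Z"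
      using fin j2' B2 d8 p k2 by (intro degree_second_moment) auto
    finally show ?thesis by (simp add: m_def power_mult_distrib)
  qed
  \<comment> \<open>\<open>w\<close> is dense, so its row sums have order \<open>n\<close> with no
    factor \<open>p\<close>. Together with \<open>4 * p * n\<close> for \<open>f\<close> and the
    bound \<open>p\<^sup>2\<close> on \<open>(X,Z)\<close>, the error has order \<open>p^3\<close>,
    like \<open>p\<close> times the second moment of \<open>g\<close>.\<close>
  have wZ: "(\<Sum>z\<in>Z. (\<Sum>y\<in>Y. \<bar>w (y,z)\<bar>)\<^sup>2) \<le> n\<^sup>2 * card Z"
  proof -
    have "(\<Sum>y\<in>Y. \<bar>w (y,z)\<bar>) \<le> n" for z
      unfolding n_def using sum_bounded_above[of Y "\<lambda>y. \<bar>w (y,z)\<bar>" 1] w by simp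
    then have "(\<Sum>z\<in>Z. (\<Sum>y\<in>Y. \<bar>w (y,z)\<bar>)\<^sup>2) \<le> (\<Sum>z\<in>Z. n\<^sup>2)"
      by (intro sum_mono power_mono) (auto intro: sum_nonneg)
    then show ?thesis by (simp add: mult_ac)
  qed

  \<comment> \<open>Removing the sparse weight \<open>a\<close>\<close>
  define U where "U = (\<Sum>y\<in>Y. \<Sum>z\<in>Z. h y z * w (y,z))"
  \<comment> \<open>Reordering puts the sum over \<open>y\<close> innermost, so that
    \<open>g\<close> appears, weighted by \<open>a\<close>.\<close>
  have "U = (\<Sum>z\<in>Z. \<Sum>y\<in>Y. \<Sum>x\<in>X. f x y * a x z * w (y,z))"
    unfolding U_def by (subst sum.swap) (simp add: h_def sum_distrib_right)
  also have "\<dots> = (\<Sum>z\<in>Z. \<Sum>x\<in>X. a x z * g x z)"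
  proof (rule sum.cong)
    show "(\<Sum>y\<in>Y. \<Sum>x\<in>X. f x y * a x z * w (y,z)) = (\<Sum>x\<in>X. a x z * g x z)" for z
      by (subst sum.swap) (simp add: g_def sum_distrib_left mult_ac)
  qed simp
  also have "\<dots> = (\<Sum>x\<in>X. \<Sum>z\<in>Z. a x z * (\<Sum>y\<in>Y. f x y * w (y,z)))"
    by (subst sum.swap) (simp add: g_def)
  \<comment> \<open>The index set \<open>R\<close> is \<open>Y\<close>, with \<open>k2\<close> as
    majorant. Main term and error each contribute at most
    \<open>32 * d^4 * p^4 * (m * n * l)\<^sup>2\<close>, whence the constant 8.\<close>
  also have "\<dots>\<^sup>2 \<le> 2 * p * card X * card Z *
      (p * (\<Sum>x\<in>X. \<Sum>z\<in>Z. (\<Sum>y\<in>Y. f x y * w (y,z))\<^sup>2)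
        + 4 * (d^8 * p\<^sup>2) * (4 * p * n) * n * card X * card Z)"
  proof (rule sparse_Cauchy_Schwarz[where k = k2 and f = "\<lambda>y x. f x y" and g = "\<lambda>y z. w (y,z)"])
    show "0 \<le> k2 x z" for x z using k2[of x z] by simp
  qed (use fin j2 B2 d8 p a f w pos fX wZ in auto)
  also have "\<dots> \<le> 2 * p * m * l * (p * (16 * d^4 * p\<^sup>2 * n\<^sup>2 * m * l) + 4 * (d^4 * p\<^sup>2) * (4 * p * n) * n * m * l)"
    using g_sq[unfolded g_def] p pos d8 unfolding m_def l_def
    by (intro mult_left_mono add_mono mult_right_mono) auto
  also have "\<dots> = (8 * d\<^sup>2 * p\<^sup>2 * m * n * l)\<^sup>2"
    by (simp add: eval_nat_numeral algebra_simps)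
  finally have "U \<le> 8 * d\<^sup>2 * p\<^sup>2 * m * n * l"
    by (rule power2_le_imp_le) (use pos in auto)
  then have "2 * p\<^sup>2 * m * U + 16 * d^4 * p^4 * m\<^sup>2 * n * l
      \<le> 2 * p\<^sup>2 * m * (8 * d\<^sup>2 * p\<^sup>2 * m * n * l) + 16 * d\<^sup>2 * p^4 * m\<^sup>2 * n * l"
    using pos d4 p by (intro add_mono mult_left_mono mult_right_mono) auto
  also have "\<dots> = 32 * d\<^sup>2 * p^4 * m\<^sup>2 * n * l" by (simp add: eval_nat_numeral algebra_simps)
  finally have h_sq': "(\<Sum>y\<in>Y. \<Sum>z\<in>Z. (h y z)\<^sup>2) \<le> 32 * d\<^sup>2 * p^4 * m\<^sup>2 * n * l"
    using h_sq unfolding U_def by linarith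

  \<comment> \<open>Removing the sparse weight \<open>b\<close>\<close>
  have "(\<Sum>y\<in>Y. \<Sum>z\<in>Z. b y z * (\<Sum>x\<in>X. f x y * a x z))\<^sup>2 \<le> 2 * p * card Y * card Z *
      (p * (\<Sum>y\<in>Y. \<Sum>z\<in>Z. (\<Sum>x\<in>X. f x y * a x z)\<^sup>2)
        + 4 * (d^8 * p^3) * (4 * p * m) * (2 * p * m) * card Y * card Z)"
  \<comment> \<open>Now \<open>R\<close> is \<open>X\<close>, and the sparse weight \<open>a\<close>
    itself is the second family.\<close>
  proof (rule sparse_Cauchy_Schwarz[where k = k3])
    show "\<bar>a x z\<bar> \<le> 1" for x z using a[of x z] k2[of x z] by simp
  qed (use fin j3 B3 d8 p k3 b f pos fY aZ in auto)
  also have "\<dots> \<le> 2 * p * n * l * (p * (32 * d\<^sup>2 * p^4 * m\<^sup>2 * n * l) + 4 * (d\<^sup>2 * p^3) * (4 * p * m) * (2 * p * m) * n * l)"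
    using h_sq'[unfolded h_def] p pos d8 unfolding n_def l_def
    by (intro mult_left_mono add_mono mult_right_mono) auto
  also have "\<dots> = 128 * (d * p^3 * m * n * l)\<^sup>2"
    by (simp add: eval_nat_numeral algebra_simps)
  \<comment> \<open>144 is the next perfect square above 128.\<close>
  also have "\<dots> \<le> 144 * (d * p^3 * m * n * l)\<^sup>2" by simp
  also have "\<dots> = (12 * d * p^3 * m * n * l)\<^sup>2" by (simp add: power_mult_distrib)
  finally have "\<bar>\<Sum>y\<in>Y. \<Sum>z\<in>Z. b y z * (\<Sum>x\<in>X. f x y * a x z)\<bar>\<^sup>2 \<le> (12 * d * p^3 * m * n * l)\<^sup>2"
    by simp
  then show ?thesis unfolding m_def n_def l_def
    by (rule power2_le_imp_le) (use p d in auto)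
qed

subsection \<open>Regularity of neighbourhoods\<close>

lemma edge_ind_sym:
  assumes "pair_graph G"
  shows "edge_ind G x y = edge_ind G y x"
proof -
  interpret pair_graph G by fact
  show ?thesis using arcs_symmetric by (auto simp: edge_ind_def)
qed

lemma edge_ind_bounds: "0 \<le> edge_ind G x y" "edge_ind G x y \<le> 1"
  by (simp_all add: edge_ind_def)

lemma jumbled_iff_form:
  "jumbled G X Y p \<beta> \<longleftrightarrow> jumbled_form (\<lambda>x y. edge_ind G x y - p) X Y \<beta>"
  by (simp add: jumbled_def jumbled_form_def)

lemma DISC_bound:
  assumes "DISC G X Y q p \<epsilon>" "finite X" "finite Y" "u \<in> X \<rightarrow> {0..1}" "v \<in> Y \<rightarrow> {0..1}"
  shows "\<bar>\<Sum>x\<in>X. \<Sum>y\<in>Y. (edge_ind G x y - q) * u x * v y\<bar> \<le> \<epsilon> * p * card X * card Y"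
proof (cases "card X = 0 \<or> card Y = 0")
  case True
  then have "X = {} \<or> Y = {}" using assms by auto
  then show ?thesis by auto
next
  case False
  define S where "S = (\<Sum>x\<in>X. \<Sum>y\<in>Y. (edge_ind G x y - q) * u x * v y)"
  have "\<bar>1 / (real (card X) * real (card Y)) * S\<bar> \<le> \<epsilon> * p"
    using assms unfolding DISC_def S_def by blast
  then have "\<bar>S\<bar> / (real (card X) * real (card Y)) \<le> \<epsilon> * p"
    by (simp add: abs_mult)
  then have "\<bar>S\<bar> \<le> \<epsilon> * p * card X * card Y" using False by (simp add: divide_le_eq mult_ac)
  then show ?thesis by (simp add: S_def)
qed

lemma DISC_mono: "DISC G X Y q p \<epsilon> \<Longrightarrow> \<epsilon> \<le> \<epsilon>' \<Longrightarrow> 0 \<le> p \<Longrightarrow> DISC G X Y q p \<epsilon>'"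
  unfolding DISC_def by (meson mult_right_mono order_trans)

lemma card_nbrs_in:
  assumes "finite X" "pair_graph G"
  shows "real (card (nbrs_in G X z)) = (\<Sum>x\<in>X. edge_ind G x z)"
proof -
  have "(\<Sum>x\<in>X. edge_ind G x z) = (\<Sum>x\<in>X. if (z, x) \<in> parcs G then 1 else 0)"
    using edge_ind_sym[OF assms(2), of _ z] by (simp add: edge_ind_def)
  then show ?thesis using assms(1) by (simp add: nbrs_in_def sum.If_cases Int_def)
qed

text \<open>Each vertex of low degree has a deficit of at least \<open>\<eta> * q * card X\<close>.
  Testing \<open>DISC\<close> with the constant 1 on \<open>X\<close> and the indicator of these
  vertices on \<open>Z\<close> bounds the total deficit; \<open>\<alpha> * p \<le> q\<close> lets
  the factor \<open>p\<close> cancel.\<close>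

lemma few_low_degree_vertices:
  fixes p q \<alpha> \<epsilon> \<eta> :: real
  assumes fin: "finite X" "finite Z" and ne: "X \<noteq> {}" and G: "pair_graph G"
    and D: "DISC G X Z q p \<epsilon>" and p: "0 < p" and q: "\<alpha> * p \<le> q" and \<eta>: "0 \<le> \<eta>"
  shows "\<eta> * \<alpha> * card {z \<in> Z. real (card (nbrs_in G X z)) < (1 - \<eta>) * q * card X} \<le> \<epsilon> * card Z"
proof -
  define B where "B = {z \<in> Z. real (card (nbrs_in G X z)) < (1 - \<eta>) * q * card X}"
  have B: "B \<subseteq> Z" "finite B" using fin by (auto simp: B_def)
  define n where "n = real (card X)"
  have n: "n > 0" using fin ne by (simp add: n_def card_gt_0_iff)
  have "\<eta> * \<alpha> * p * n * card B \<le> \<eta> * q * n * card B"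
    using mult_left_mono[OF q \<eta>] n by (intro mult_right_mono) (auto simp: mult_ac)
  also have "\<dots> = (\<Sum>z\<in>B. \<eta> * q * n)" by simp
  also have "\<dots> \<le> (\<Sum>z\<in>B. - (\<Sum>x\<in>X. edge_ind G x z - q))"
    using card_nbrs_in[OF fin(1) G]
    by (intro sum_mono) (auto simp: B_def sum_subtractf n_def algebra_simps)
  also have "\<dots> = - (\<Sum>z\<in>Z. (\<Sum>x\<in>X. edge_ind G x z - q) * indicator B z)"
    using B fin by (simp add: sum_negf indicator_def if_distrib sum.If_cases Int_absorb1 cong: if_cong)
  also have "\<dots> = - (\<Sum>x\<in>X. \<Sum>z\<in>Z. (edge_ind G x z - q) * 1 * indicator B z)"
    by (subst sum.swap) (simp add: sum_distrib_right)
  also have "\<dots> \<le> \<epsilon> * p * card X * card Z"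
    using DISC_bound[OF D fin, of "\<lambda>_. 1" "indicator B"] by (fastforce simp: indicator_def)
  finally have "(p * n) * (\<eta> * \<alpha> * card B) \<le> (p * n) * (\<epsilon> * card Z)"
    by (simp add: n_def mult_ac)
  then show ?thesis using p n unfolding B_def by simp
qed

lemma not_DISC_witness:
  assumes "\<not> DISC G X Y q p \<epsilon>" "0 \<le> \<epsilon> * p" "finite X" "finite Y"
  obtains u v where "u \<in> X \<rightarrow> {0..1}" "v \<in> Y \<rightarrow> {0..1}"
    "\<bar>\<Sum>x\<in>X. \<Sum>y\<in>Y. (edge_ind G x y - q) * u x * v y\<bar> \<ge> \<epsilon> * p * card X * card Y"
proof -
  obtain u v where uv: "u \<in> X \<rightarrow> {0..1}" "v \<in> Y \<rightarrow> {0..1}" and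
    less: "\<bar>1 / (real (card X) * real (card Y)) *
         (\<Sum>x\<in>X. \<Sum>y\<in>Y. (edge_ind G x y - q) * u x * v y)\<bar> > \<epsilon> * p"
    using assms(1) unfolding DISC_def by (auto simp: not_le)
  \<comment> \<open>Division by 0 yields 0, so an empty side would contradict
    \<open>less\<close>.\<close>
  have "card X \<noteq> 0" "card Y \<noteq> 0" using less assms by auto
  with less have "\<bar>\<Sum>x\<in>X. \<Sum>y\<in>Y. (edge_ind G x y - q) * u x * v y\<bar> \<ge> \<epsilon> * p * card X * card Y"
    by (simp add: abs_mult less_divide_eq mult_ac)
  with uv show ?thesis by (rule that)
qed

text \<open>The defects of all irregular \<open>z\<close> are assembled into one weighted triangle
  sum. Degrees of at least half the expected size enter because a failure of \<open>DISC\<close> is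
  measured relative to the product of the neighbourhood sizes; the two halves turn 12 into
  48.\<close>

lemma few_irregular_neighbourhoods:
  fixes \<Gamma> G :: "'a pair_pre_digraph"
    and \<alpha> d e p qXY qXZ qYZ :: real
  assumes fin: "finite X" "finite Y" "finite Z" and ne: "X \<noteq> {}" "Y \<noteq> {}"
    and \<Gamma>: "pair_graph \<Gamma>" and G: "pair_graph G" "parcs G \<subseteq> parcs \<Gamma>"
    and p: "0 < p" "p \<le> 1" and d: "0 < d" "d \<le> 1/2" and e: "0 < e" and \<alpha>: "0 < \<alpha>"
    and q: "qXY \<in> {0..p}" "\<alpha> * p \<le> qXZ" "\<alpha> * p \<le> qYZ"
    and j: "jumbled \<Gamma> X Y p (d^8 * p^4 * sqrt (card X * card Y))"
      "jumbled \<Gamma> X Z p (d^8 * p^2 * sqrt (card X * card Z))"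
      "jumbled \<Gamma> Y Z p (d^8 * p^3 * sqrt (card Y * card Z))"
    and D: "DISC G X Y qXY p (d^4)"
  shows "e * \<alpha>\<^sup>2 * card {z \<in> Z. card (nbrs_in G X z) \<ge> qXZ * card X / 2 \<and>
      card (nbrs_in G Y z) \<ge> qYZ * card Y / 2 \<and>
      \<not> DISC G (nbrs_in G X z) (nbrs_in G Y z) qXY p e} \<le> 48 * d * card Z"
proof -
  define B where "B = {z \<in> Z. card (nbrs_in G X z) \<ge> qXZ * card X / 2 \<and>
      card (nbrs_in G Y z) \<ge> qYZ * card Y / 2 \<and>
      \<not> DISC G (nbrs_in G X z) (nbrs_in G Y z) qXY p e}"
  define m n where "m = real (card X)" and "n = real (card Y)"
  have pos: "0 < m" "0 < n" using fin ne by (auto simp: m_def n_def card_gt_0_iff)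
  have B: "B \<subseteq> Z" using fin by (auto simp: B_def)
  define f where "f x y = edge_ind G x y - qXY" for x y
  have N: "nbrs_in G X z \<subseteq> X" "nbrs_in G Y z \<subseteq> Y" for z by (auto simp: nbrs_in_def)
  note finN = finite_subset[OF N(1) fin(1)] finite_subset[OF N(2) fin(2)]
  define S where "S u v z = (\<Sum>x\<in>nbrs_in G X z. \<Sum>y\<in>nbrs_in G Y z. f x y * u x * v y)" for u v z
  have "\<exists>u v. u \<in> nbrs_in G X z \<rightarrow> {0..1} \<and> v \<in> nbrs_in G Y z \<rightarrow> {0..1} \<and>
      \<bar>S u v z\<bar> \<ge> e * p * card (nbrs_in G X z) * card (nbrs_in G Y z)" if "z \<in> B" for z
  proof -
    have nD: "\<not> DISC G (nbrs_in G X z) (nbrs_in G Y z) qXY p e" using that by (simp add: B_def)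
    show ?thesis
      by (rule not_DISC_witness[OF nD _ finN]) (use e p in \<open>auto simp: S_def f_def\<close>)
  qed
  then obtain u v where u: "\<And>z. z \<in> B \<Longrightarrow> u z \<in> nbrs_in G X z \<rightarrow> {0..1}"
    and v: "\<And>z. z \<in> B \<Longrightarrow> v z \<in> nbrs_in G Y z \<rightarrow> {0..1}"
    and S: "\<And>z. z \<in> B \<Longrightarrow> \<bar>S (u z) (v z) z\<bar> \<ge> e * p * card (nbrs_in G X z) * card (nbrs_in G Y z)"
    by metis
  \<comment> \<open>The witnesses are extended by zero, so that \<open>\<Gamma>\<close> majorizes
    them. The sign placed in \<open>b\<close> makes the contributions of different \<open>z\<close>
    add up instead of cancelling.\<close>
  define a where "a x z = (if z \<in> B \<and> x \<in> nbrs_in G X z then u z x else 0)" for x z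
  define b where "b y z = (if z \<in> B \<and> y \<in> nbrs_in G Y z then sgn (S (u z) (v z) z) * v z y else 0)" for y z
  have S_eq: "(\<Sum>y\<in>Y. b y z * (\<Sum>x\<in>X. f x y * a x z)) = (if z \<in> B then \<bar>S (u z) (v z) z\<bar> else 0)" for z
  proof (cases "z \<in> B")
    case True
    have "(\<Sum>x\<in>X. f x y * a x z) = (\<Sum>x\<in>nbrs_in G X z. f x y * a x z)" for y
      using fin N by (intro sum.mono_neutral_right) (auto simp: a_def)
    then have "(\<Sum>y\<in>Y. b y z * (\<Sum>x\<in>X. f x y * a x z)) =
        (\<Sum>y\<in>nbrs_in G Y z. b y z * (\<Sum>x\<in>nbrs_in G X z. f x y * a x z))"
      using fin N[of z]
      by (intro sum.mono_neutral_cong_right) (auto simp: b_def)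
    also have "\<dots> = sgn (S (u z) (v z) z) * (\<Sum>y\<in>nbrs_in G Y z. \<Sum>x\<in>nbrs_in G X z. f x y * u z x * v z y)"
      using True by (simp add: a_def b_def sum_distrib_left mult_ac)
    also have "\<dots> = sgn (S (u z) (v z) z) * S (u z) (v z) z"
      by (subst sum.swap) (simp add: S_def)
    finally show ?thesis using True by (simp add: abs_sgn mult.commute)
  qed (simp add: b_def)
  have edge\<Gamma>: "edge_ind \<Gamma> x z = 1" if "x \<in> nbrs_in G W z" for x z W
    using that G(2) edge_ind_sym[OF \<Gamma>, of x z] by (auto simp: edge_ind_def nbrs_in_def)
  have sgn1: "\<bar>sgn (r::real)\<bar> \<le> 1" for r by (simp add: sgn_if)
  have "real (card B) * (e * \<alpha>\<^sup>2 * p^3 * m * n / 4) = (\<Sum>z\<in>B. e * p * (\<alpha> * p * m / 2) * (\<alpha> * p * n / 2))"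
    by (simp add: eval_nat_numeral)
  also have "\<dots> \<le> (\<Sum>z\<in>B. \<bar>S (u z) (v z) z\<bar>)"
  proof (rule sum_mono)
    fix z assume z: "z \<in> B"
    have "\<alpha> * p * m \<le> qXZ * m" "\<alpha> * p * n \<le> qYZ * n" using q pos by (auto intro: mult_right_mono)
    then have "\<alpha> * p * m / 2 \<le> card (nbrs_in G X z)" "\<alpha> * p * n / 2 \<le> card (nbrs_in G Y z)"
      using z by (auto simp: B_def m_def n_def)
    then have "e * p * (\<alpha> * p * m / 2) * (\<alpha> * p * n / 2) \<le> e * p * card (nbrs_in G X z) * card (nbrs_in G Y z)"
      using e p \<alpha> pos by (intro mult_mono mult_left_mono) auto
    with S[OF z] show "e * p * (\<alpha> * p * m / 2) * (\<alpha> * p * n / 2) \<le> \<bar>S (u z) (v z) z\<bar>" by linarith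
  qed
  also have "\<dots> = (\<Sum>z\<in>Z. if z \<in> B then \<bar>S (u z) (v z) z\<bar> else 0)"
    using B fin by (simp add: sum.If_cases Int_absorb1)
  also have "\<dots> = (\<Sum>y\<in>Y. \<Sum>z\<in>Z. b y z * (\<Sum>x\<in>X. f x y * a x z))"
    by (subst sum.swap) (simp add: S_eq)
  also have "\<dots> \<le> \<bar>\<Sum>y\<in>Y. \<Sum>z\<in>Z. b y z * (\<Sum>x\<in>X. f x y * a x z)\<bar>" by simp
  also have "\<dots> \<le> 12 * d * p^3 * card X * card Y * card Z"
  proof (rule sparse_triangle_count[OF fin ne p d])
    show "\<bar>f x y\<bar> \<le> 1" for x y using q p by (auto simp: f_def edge_ind_def)
    \<comment> \<open>On edges of \<open>G\<close> the majorant is at least 1; elsewhere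
      \<open>f\<close> is \<open>- qXY\<close>, at most \<open>p\<close> in absolute value.\<close>
    show "\<bar>f x y\<bar> \<le> edge_ind \<Gamma> x y + p" for x y
      using q p G(2) by (auto simp: f_def edge_ind_def)
    show "\<bar>a x z\<bar> \<le> edge_ind \<Gamma> x z" for x z
      using u[of z] edge\<Gamma>[of x X z] edge_ind_bounds[of \<Gamma> x z] by (auto simp: a_def Pi_iff)
    show "\<bar>b y z\<bar> \<le> edge_ind \<Gamma> y z" for y z
      using v[of z] edge\<Gamma>[of y Y z] edge_ind_bounds[of \<Gamma> y z] sgn1
      by (auto simp: b_def Pi_iff abs_mult intro!: mult_le_one)
    show "\<bar>\<Sum>x\<in>X. \<Sum>y\<in>Y. f x y * u x * v y\<bar> \<le> d^4 * p * card X * card Y"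
      if "u \<in> X \<rightarrow> {0..1}" "v \<in> Y \<rightarrow> {0..1}" for u v
      using DISC_bound[OF D fin(1,2) that] by (simp add: f_def)
  qed (use j edge_ind_bounds in \<open>auto simp: jumbled_iff_form\<close>)
  finally have "(p^3 * m * n / 4) * (e * \<alpha>\<^sup>2 * card B) \<le> (p^3 * m * n / 4) * (48 * d * card Z)"
    by (simp add: m_def n_def mult_ac)
  then show ?thesis using p pos unfolding B_def by simp
qed

text \<open>Union bound over the exceptional vertices: low degree into \<open>X\<close> or into
  \<open>Y\<close>, a share \<open>\<xi>/4\<close> each, and irregular pairs of neighbourhoods, a
  share \<open>\<xi>/2\<close>. The 96 in \<open>d\<close> makes \<open>48 * d\<close> equal to
  \<open>e * \<alpha>\<^sup>2 * \<xi> / 2\<close>.\<close>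

lemma neighbourhood_regularity:
  fixes \<Gamma> G :: "'a pair_pre_digraph"
    and \<alpha> \<xi> d e p qXY qXZ qYZ :: real
  assumes \<alpha>: "0 < \<alpha>" "\<alpha> \<le> 1" and \<xi>: "0 < \<xi>" "\<xi> \<le> 1" and e: "0 < e" "e \<le> 1"
    and d_def: "d = \<alpha>\<^sup>2 * \<xi> * e / 96"
    and p: "0 < p" "p \<le> 1"
    and q: "qXY \<in> {\<alpha> * p..p}" "\<alpha> * p \<le> qXZ" "\<alpha> * p \<le> qYZ"
    and T: "tripartite \<Gamma> X Y Z" and G: "pair_graph G" "subgraph (with_proj G) (with_proj \<Gamma>)"
    and j: "jumbled \<Gamma> X Y p (d^8 * p^4 * sqrt (card X * card Y))"
      "jumbled \<Gamma> X Z p (d^8 * p^2 * sqrt (card X * card Z))"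
      "jumbled \<Gamma> Y Z p (d^8 * p^3 * sqrt (card Y * card Z))"
    and D: "DISC G X Y qXY p (d^4)" "DISC G X Z qXZ p (d^4)" "DISC G Y Z qYZ p (d^4)"
  shows "card {z \<in> Z. card (nbrs_in G X z) \<ge> (1 - \<xi>) * qXZ * card X \<and>
      card (nbrs_in G Y z) \<ge> (1 - \<xi>) * qYZ * card Y \<and>
      DISC G (nbrs_in G X z) (nbrs_in G Y z) qXY p e} \<ge> (1 - \<xi>) * card Z"
proof -
  have \<Gamma>: "pair_graph \<Gamma>" and ne: "X \<noteq> {}" "Y \<noteq> {}" using T by (auto simp: tripartite_def)
  have "finite (X \<union> Y \<union> Z)"
  proof -
    interpret pair_graph \<Gamma> by fact
    show ?thesis using T finite_verts by (simp add: tripartite_def)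
  qed
  then have fin: "finite X" "finite Y" "finite Z" by auto
  have sub: "parcs G \<subseteq> parcs \<Gamma>" using G(2) by (auto simp: subgraph_def)
  have "\<alpha>\<^sup>2 * \<xi> * e \<le> \<alpha>\<^sup>2 * \<xi>" using mult_left_mono[OF e(2), of "\<alpha>\<^sup>2 * \<xi>"] \<xi> by simp
  moreover have \<alpha>2: "\<alpha>\<^sup>2 \<le> \<alpha>" using \<alpha> power_decreasing[of 1 2 \<alpha>] by simp
  then have "\<alpha>\<^sup>2 * \<xi> \<le> \<alpha> * \<xi>" using \<xi> by simp
  ultimately have "\<alpha>\<^sup>2 * \<xi> * e \<le> \<alpha> * \<xi>" by linarith
  then have d: "0 < d" "d \<le> \<alpha> * \<xi> / 96"
    using \<alpha> \<xi> e divide_right_mono[of _ _ 96] unfolding d_def by auto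
  moreover have "\<alpha> * \<xi> \<le> 1" using \<alpha> \<xi> by (simp add: mult_le_one)
  ultimately have d1: "d \<le> 1/2" by simp
  \<comment> \<open>The target \<open>\<alpha> * \<xi>\<^sup>2 / 8\<close> is the product of
    \<open>\<xi>/2 * \<alpha>\<close>, the factor in the count of low degrees, and the allowed share
    \<open>\<xi>/4\<close>.\<close>
  have "d^4 \<le> d\<^sup>2" using d d1 power_decreasing[of 2 4 d] by simp
  also have "\<dots> \<le> (\<alpha> * \<xi> / 96)\<^sup>2" using d by (intro power_mono) auto
  also have "\<dots> = \<alpha>\<^sup>2 * \<xi>\<^sup>2 / 9216" by (simp add: power_divide power_mult_distrib)
  also have "\<dots> \<le> \<alpha> * \<xi>\<^sup>2 / 8"
    using mult_right_mono[OF \<alpha>2, of "\<xi>\<^sup>2"] \<alpha> by (intro frac_le) auto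
  finally have d4: "d^4 \<le> \<alpha> * \<xi>\<^sup>2 / 8" .
  \<comment> \<open>As \<open>\<xi> \<le> 1\<close>, the factor \<open>1 - \<xi>/2\<close> is at
    least both \<open>1 - \<xi>\<close> and 1/2. Vertices outside \<open>low\<close> thus satisfy
    the degree claims and also the half-degree conditions in \<open>B\<close>.\<close>
  define low where "low W q = {z \<in> Z. real (card (nbrs_in G W z)) < (1 - \<xi>/2) * q * card W}" for W q
  have low: "card (low W q) \<le> \<xi>/4 * card Z"
    if "finite W" "W \<noteq> {}" "DISC G W Z q p (d^4)" "\<alpha> * p \<le> q" for W q
  proof -
    have "\<xi>/2 * \<alpha> * card (low W q) \<le> d^4 * card Z"
      unfolding low_def using that fin G p \<xi> by (intro few_low_degree_vertices) auto
    also have "\<dots> \<le> \<alpha> * \<xi>\<^sup>2 / 8 * card Z" using d4 by (intro mult_right_mono) auto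
    finally have "(\<xi>/2 * \<alpha>) * card (low W q) \<le> (\<xi>/2 * \<alpha>) * (\<xi>/4 * card Z)"
      by (simp add: power2_eq_square mult_ac)
    then show ?thesis by (rule mult_left_le_imp_le) (use \<alpha> \<xi> in simp)
  qed
  define B where "B = {z \<in> Z. card (nbrs_in G X z) \<ge> qXZ * card X / 2 \<and>
      card (nbrs_in G Y z) \<ge> qYZ * card Y / 2 \<and>
      \<not> DISC G (nbrs_in G X z) (nbrs_in G Y z) qXY p e}"
  have q0: "0 \<le> qXY" "0 \<le> qXZ" "0 \<le> qYZ" using q mult_pos_pos[OF \<alpha>(1) p(1)] by auto
  have "e * \<alpha>\<^sup>2 * card B \<le> 48 * d * card Z"
    unfolding B_def using fin ne \<Gamma> G(1) sub p d(1) d1 e(1) \<alpha>(1) q q0 j D(1)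
    by (intro few_irregular_neighbourhoods) auto
  then have "(e * \<alpha>\<^sup>2) * card B \<le> (e * \<alpha>\<^sup>2) * (\<xi>/2 * card Z)" by (simp add: d_def mult_ac)
  then have B: "card B \<le> \<xi>/2 * card Z" by (rule mult_left_le_imp_le) (use e \<alpha> in simp)
  define good where "good = {z \<in> Z. card (nbrs_in G X z) \<ge> (1 - \<xi>) * qXZ * card X \<and>
      card (nbrs_in G Y z) \<ge> (1 - \<xi>) * qYZ * card Y \<and>
      DISC G (nbrs_in G X z) (nbrs_in G Y z) qXY p e}"
  have weaken: "(1 - \<xi>) * q * n \<le> r" "q * n / 2 \<le> r" if "(1 - \<xi>/2) * q * n \<le> r" "0 \<le> q" "0 \<le> n" for q n r :: real
  proof -
    have "(1 - \<xi>) * (q * n) \<le> (1 - \<xi>/2) * (q * n)" "1/2 * (q * n) \<le> (1 - \<xi>/2) * (q * n)"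
      by (rule mult_right_mono; use that \<xi> in simp)+
    with that show "(1 - \<xi>) * q * n \<le> r" "q * n / 2 \<le> r" by (auto simp: mult.assoc)
  qed
  have "Z \<subseteq> good \<union> (low X qXZ \<union> low Y qYZ \<union> B)"
    using weaken[OF _ q0(2)] weaken[OF _ q0(3)] by (auto simp: good_def low_def B_def not_less not_le)
  then have "card Z \<le> card (good \<union> (low X qXZ \<union> low Y qYZ \<union> B))"
    using fin by (intro card_mono) (auto simp: good_def low_def B_def)
  also have "\<dots> \<le> card good + (card (low X qXZ) + card (low Y qYZ) + card B)"
    by (meson add_left_mono add_right_mono card_Un_le order_trans)
  finally have "real (card Z) \<le> card good + (card (low X qXZ) + card (low Y qYZ) + card B)"
    by linarith
  also have "\<dots> \<le> card good + (\<xi>/4 * card Z + \<xi>/4 * card Z + \<xi>/2 * card Z)"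
    using B low[OF fin(1) ne(1) D(2) q(2)] low[OF fin(2) ne(2) D(3) q(3)] by simp
  finally show ?thesis unfolding good_def by (simp add: algebra_simps)
qed

text \<open>Fixing \<open>C\<close> and \<open>K\<close> before the parameters expresses the
  polynomial dependence; the lower bounds concern the range where all three parameters are at most
  1.\<close>

theorem proposition1p13:
  shows "\<exists>(C::real) > 0. \<exists>K::nat.
    \<forall>(\<alpha>::real) > 0. \<forall>(\<xi>::real) > 0. \<forall>(\<epsilon>'::real) > 0.
    \<exists>(c::real) > 0. \<exists>(\<epsilon>::real) > 0.
      (\<alpha> \<le> 1 \<and> \<xi> \<le> 1 \<and> \<epsilon>' \<le> 1 \<longrightarrow>
         c \<ge> C * (\<alpha> * \<xi> * \<epsilon>') ^ K \<and> \<epsilon> \<ge> C * (\<alpha> * \<xi> * \<epsilon>') ^ K) \<and>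
      (\<forall>(p::real) qXY qXZ qYZ (\<Gamma> :: 'a pair_pre_digraph) (G :: 'a pair_pre_digraph) X Y Z.
         0 < p \<and> p \<le> 1 \<and>
         qXY \<in> {\<alpha> * p..p} \<and> qXZ \<in> {\<alpha> * p..p} \<and> qYZ \<in> {\<alpha> * p..p} \<and>
         tripartite \<Gamma> X Y Z \<and>
         pair_graph G \<and> subgraph (with_proj G) (with_proj \<Gamma>) \<and>
         jumbled \<Gamma> X Y p (c * p ^ 4 * sqrt (real (card X) * real (card Y))) \<and>
         DISC G X Y qXY p \<epsilon> \<and>
         jumbled \<Gamma> X Z p (c * p ^ 2 * sqrt (real (card X) * real (card Z))) \<and>
         DISC G X Z qXZ p \<epsilon> \<and>
         jumbled \<Gamma> Y Z p (c * p ^ 3 * sqrt (real (card Y) * real (card Z))) \<and>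
         DISC G Y Z qYZ p \<epsilon>
         \<longrightarrow>
         real (card {z \<in> Z.
             real (card (nbrs_in G X z)) \<ge> (1 - \<xi>) * qXZ * real (card X) \<and>
             real (card (nbrs_in G Y z)) \<ge> (1 - \<xi>) * qYZ * real (card Y) \<and>
             DISC G (nbrs_in G X z) (nbrs_in G Y z) qXY p \<epsilon>'})
           \<ge> (1 - \<xi>) * real (card Z))"
proof (rule exI[of _ "(1/96)^8"], rule conjI, simp, rule exI[of _ 16], intro allI impI)
  fix \<alpha> \<xi> \<epsilon>' :: real
  assume pos: "0 < \<alpha>" "0 < \<xi>" "0 < \<epsilon>'"
  \<comment> \<open>Parameters are capped at 1: a smaller \<open>\<alpha>\<close> widens the range
    of densities, and a smaller \<open>\<epsilon>'\<close> strengthens the conclusion. The witnesses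
    are \<open>c = d^8\<close> and \<open>\<epsilon> = d^4\<close>.\<close>
  define d where "d = (min \<alpha> 1)\<^sup>2 * min \<xi> 1 * min \<epsilon>' 1 / 96"
  have d0: "0 < d" using pos by (simp add: d_def)
  \<comment> \<open>As \<open>\<xi>\<close> and \<open>\<epsilon>'\<close> are at most 1,
    \<open>d\<close> is at least \<open>(\<alpha> * \<xi> * \<epsilon>')\<^sup>2 / 96\<close>. The
    eighth power gives the exponent 16, and \<open>d \<le> 1\<close> makes \<open>d^4\<close> at
    least \<open>d^8\<close>.\<close>
  have poly: "(1/96)^8 * (\<alpha> * \<xi> * \<epsilon>')^16 \<le> d^8 \<and> (1/96)^8 * (\<alpha> * \<xi> * \<epsilon>')^16 \<le> d^4"
    if le1: "\<alpha> \<le> 1 \<and> \<xi> \<le> 1 \<and> \<epsilon>' \<le> 1"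
  proof -
    have "\<xi>\<^sup>2 \<le> \<xi>" "\<epsilon>'\<^sup>2 \<le> \<epsilon>'"
      using le1 pos power_decreasing[of 1 2 \<xi>] power_decreasing[of 1 2 \<epsilon>'] by auto
    then have "\<alpha>\<^sup>2 * \<xi>\<^sup>2 * \<epsilon>'\<^sup>2 \<le> \<alpha>\<^sup>2 * \<xi> * \<epsilon>'"
      using pos by (intro mult_mono mult_left_mono) auto
    then have "1/96 * (\<alpha> * \<xi> * \<epsilon>')\<^sup>2 \<le> d"
      using le1 by (simp add: d_def min_absorb1 power_mult_distrib)
    then have "(1/96 * (\<alpha> * \<xi> * \<epsilon>')\<^sup>2)^8 \<le> d^8" by (rule power_mono) simp
    then have *: "(1/96)^8 * (\<alpha> * \<xi> * \<epsilon>')^16 \<le> d^8"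
      by (simp only: power_mult_distrib flip: power_mult) simp
    have "\<alpha>\<^sup>2 * \<xi> * \<epsilon>' \<le> 1" using le1 pos by (intro mult_le_one power_le_one) auto
    then have "d \<le> 1" using le1 by (simp add: d_def min_absorb1)
    then have "d^8 \<le> d^4" using d0 by (intro power_decreasing) auto
    with * show ?thesis by linarith
  qed
  have main: "real (card {z \<in> Z.
             real (card (nbrs_in G X z)) \<ge> (1 - \<xi>) * qXZ * real (card X) \<and>
             real (card (nbrs_in G Y z)) \<ge> (1 - \<xi>) * qYZ * real (card Y) \<and>
             DISC G (nbrs_in G X z) (nbrs_in G Y z) qXY p \<epsilon>'})
           \<ge> (1 - \<xi>) * real (card Z)"
    if p: "0 < p" "p \<le> 1" and q: "qXY \<in> {\<alpha> * p..p}" "qXZ \<in> {\<alpha> * p..p}" "qYZ \<in> {\<alpha> * p..p}"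
      and T: "tripartite \<Gamma> X Y Z" and G: "pair_graph G" "subgraph (with_proj G) (with_proj \<Gamma>)"
      and j: "jumbled \<Gamma> X Y p (d^8 * p ^ 4 * sqrt (real (card X) * real (card Y)))"
        "jumbled \<Gamma> X Z p (d^8 * p ^ 2 * sqrt (real (card X) * real (card Z)))"
        "jumbled \<Gamma> Y Z p (d^8 * p ^ 3 * sqrt (real (card Y) * real (card Z)))"
      and D: "DISC G X Y qXY p (d^4)" "DISC G X Z qXZ p (d^4)" "DISC G Y Z qYZ p (d^4)"
    for p qXY qXZ qYZ :: real and \<Gamma> G :: "'a pair_pre_digraph" and X Y Z
  proof (cases "\<xi> \<le> 1")
    case True
    have "finite Z"
    proof -
      interpret pair_graph \<Gamma> using T by (simp add: tripartite_def)
      show ?thesis using T finite_verts by (simp add: tripartite_def)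
    qed
    have "min \<alpha> 1 * p \<le> \<alpha> * p" using p by (intro mult_right_mono) auto
    then have q': "qXY \<in> {min \<alpha> 1 * p..p}" "min \<alpha> 1 * p \<le> qXZ" "min \<alpha> 1 * p \<le> qYZ"
      using q by auto
    have "(1 - \<xi>) * real (card Z) \<le> card {z \<in> Z. card (nbrs_in G X z) \<ge> (1 - \<xi>) * qXZ * card X \<and>
      card (nbrs_in G Y z) \<ge> (1 - \<xi>) * qYZ * card Y \<and>
      DISC G (nbrs_in G X z) (nbrs_in G Y z) qXY p (min \<epsilon>' 1)}"
    proof (rule neighbourhood_regularity[OF _ _ _ True _ _ _ p q' T G _ _ _ D])
      show "d = (min \<alpha> 1)\<^sup>2 * \<xi> * min \<epsilon>' 1 / 96" using True by (simp add: d_def)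
    qed (use pos j in auto)
    also have "\<dots> \<le> real (card {z \<in> Z.
             real (card (nbrs_in G X z)) \<ge> (1 - \<xi>) * qXZ * real (card X) \<and>
             real (card (nbrs_in G Y z)) \<ge> (1 - \<xi>) * qYZ * real (card Y) \<and>
             DISC G (nbrs_in G X z) (nbrs_in G Y z) qXY p \<epsilon>'})"
      using \<open>finite Z\<close> p by (intro of_nat_mono card_mono) (auto elim: DISC_mono)
    finally show ?thesis .
  next
    \<comment> \<open>For \<open>\<xi> > 1\<close> the required number of vertices is not
      positive.\<close>
    case False
    then have "(1 - \<xi>) * real (card Z) \<le> 0" by (simp add: mult_le_0_iff)
    then show ?thesis by linarith
  qed
  show "\<exists>c>0. \<exists>\<epsilon>>0.
      (\<alpha> \<le> 1 \<and> \<xi> \<le> 1 \<and> \<epsilon>' \<le> 1 \<longrightarrow>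
         c \<ge> (1/96)^8 * (\<alpha> * \<xi> * \<epsilon>') ^ 16 \<and> \<epsilon> \<ge> (1/96)^8 * (\<alpha> * \<xi> * \<epsilon>') ^ 16) \<and>
      (\<forall>(p::real) qXY qXZ qYZ (\<Gamma> :: 'a pair_pre_digraph) (G :: 'a pair_pre_digraph) X Y Z.
         0 < p \<and> p \<le> 1 \<and>
         qXY \<in> {\<alpha> * p..p} \<and> qXZ \<in> {\<alpha> * p..p} \<and> qYZ \<in> {\<alpha> * p..p} \<and>
         tripartite \<Gamma> X Y Z \<and>
         pair_graph G \<and> subgraph (with_proj G) (with_proj \<Gamma>) \<and>
         jumbled \<Gamma> X Y p (c * p ^ 4 * sqrt (real (card X) * real (card Y))) \<and>
         DISC G X Y qXY p \<epsilon> \<and>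
         jumbled \<Gamma> X Z p (c * p ^ 2 * sqrt (real (card X) * real (card Z))) \<and>
         DISC G X Z qXZ p \<epsilon> \<and>
         jumbled \<Gamma> Y Z p (c * p ^ 3 * sqrt (real (card Y) * real (card Z))) \<and>
         DISC G Y Z qYZ p \<epsilon>
         \<longrightarrow>
         real (card {z \<in> Z.
             real (card (nbrs_in G X z)) \<ge> (1 - \<xi>) * qXZ * real (card X) \<and>
             real (card (nbrs_in G Y z)) \<ge> (1 - \<xi>) * qYZ * real (card Y) \<and>
             DISC G (nbrs_in G X z) (nbrs_in G Y z) qXY p \<epsilon>'})
           \<ge> (1 - \<xi>) * real (card Z))"
    using d0 poly main by (intro exI[of _ "d^8"] conjI exI[of _ "d^4"]) (simp_all only: zero_less_power, blast+)
qed

end
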